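(* Fix $0<p<2$. For $\eta>0$ and $n\ge 1$ let $R_n^*(M_{n,p}(\eta))=\inf_{\hat\mu}\sup_{\mu\in M_{n,p}(\eta)}R_n(\hat\mu,\mu)$ be the minimax risk. Then $$\lim_{\eta\to 0}\left[\frac{\lim_{n\to\infty}R_n^*(M_{n,p}(\eta))}{\eta^p\log^{2-p}\log\frac{1}{\eta}}\right]=1.$$
   Context: Observations: $X_1,\dots,X_n$ are independent with $X_i\sim\mathrm{Exp}(\mu_i)$, i.e. exponential with mean $\mu_i$ (density $\mu_i^{-1}e^{-x/\mu_i}$ on $x>0$), where $\mu=(\mu_1,\dots,\mu_n)$ is a deterministic vector with all $\mu_i\ge 1$. The parameter space is $M_{n,p}(\eta)=\{\mu\in[1,\infty)^n:\ \frac1n\sum_{i=1}^n\log^p(\mu_i)\le\eta^p\}$. For an estimator $\hat\mu=\hat\mu(X_1,\dots,X_n)$ with values in $(0,\infty)^n$, the risk is $R_n(\hat\mu,\mu)=\mathbb{E}_\mu\big[\frac1n\sum_{i=1}^n(\log\hat\mu_i-\log\mu_i)^2\big]$. The infimum in the minimax risk is over all such estimators. *)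

theory Defs
  imports "HOL-Probability.Probability"
begin

text \<open>Law of the data: independent X_i ~ Exp with MEAN mu_i (rate 1/mu_i), i < n.\<close>
definition data_law :: "nat \<Rightarrow> (nat \<Rightarrow> real) \<Rightarrow> (nat \<Rightarrow> real) measure" where
  "data_law n mu = PiM {..<n} (\<lambda>i. density lborel (exponential_density (1 / mu i)))"

definition estimators :: "nat \<Rightarrow> ((nat \<Rightarrow> real) \<Rightarrow> (nat \<Rightarrow> real)) set" where
  "estimators n = {est. (\<forall>i<n. (\<lambda>x. est x i) \<in> borel_measurable (PiM {..<n} (\<lambda>_. lborel)))
                      \<and> (\<forall>x\<in>space (PiM {..<n} (\<lambda>_. lborel)). \<forall>i<n. est x i > 0)}"

definition param_space :: "nat \<Rightarrow> real \<Rightarrow> real \<Rightarrow> (nat \<Rightarrow> real) set" where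
  "param_space n p eta = {mu. (\<forall>i<n. mu i \<ge> 1) \<and>
      (1 / real n) * (\<Sum>i<n. (ln (mu i)) powr p) \<le> eta powr p}"

definition risk :: "nat \<Rightarrow> ((nat \<Rightarrow> real) \<Rightarrow> (nat \<Rightarrow> real)) \<Rightarrow> (nat \<Rightarrow> real) \<Rightarrow> ennreal" where
  "risk n est mu = (\<integral>\<^sup>+ x. ennreal ((1 / real n) * (\<Sum>i<n. (ln (est x i) - ln (mu i))\<^sup>2)) \<partial>data_law n mu)"

definition minimax_risk :: "nat \<Rightarrow> real \<Rightarrow> real \<Rightarrow> ennreal" where
  "minimax_risk n p eta = (INF est\<in>estimators n. SUP mu\<in>param_space n p eta. risk n est mu)"

end

theory Submission
  imports Defs "HOL-Real_Asymp.Real_Asymp"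
begin

text \<open>
  Write $R_n^*$ for the minimax risk over the parameter space with a fixed $\eta$.  Products of
  priors show that $n R_n^*$ is superadditive, once $R_n^*$ is known to be a supremum of Bayes risks
  over finitely supported priors; hence $R_n^*$ converges to $\sup_n R_n^*$.  The minimax theorem
  behind this needs no compactness of the estimators: rounding $\log\mu$ down to a grid of mesh $c$
  and rescaling the data by $e^{-c}$ costs a factor $e^{cn}$ in the likelihood, and on the finite
  grid a Blackwell approachability argument produces a nearly minimax estimator by averaging best
  responses.

  Upper bound: with $u = \log(1/\eta)$, estimate $\log\mu_i$ by $\log X_i$ if $X_i > 6u$ and by $0$
  otherwise.  Lower bound: put a single spike of height $m = \log u - 2\log\log u$ at a uniformly
  random place among $n \approx m^p/\eta^p$ coordinates.  Since $e^m \log u = u / \log u = o(\log n)$,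
  a typical observation at the spike is not distinguishable from the null coordinates, and
  the Bayes risk is asymptotically $m^2/n$.
\<close>

subsection \<open>A minimax theorem for finitely many parameters\<close>

text \<open>Where the factor \<open>log^(2-p) log (1/eta)\<close> comes from: a threshold
  \<open>t\<close> must hold the error of the near-null coordinates below order
  \<open>eta^p\<close>, and exponential tails achieve this once \<open>t\<close> is a large enough
  multiple of \<open>u\<close>. On the log scale the threshold sits at \<open>ln t\<close>, which is
  asymptotic to \<open>ln u\<close>. A coordinate with \<open>ln (mu i) = \<theta>\<close> costs
  about \<open>\<theta>^2\<close> below that height and a bounded amount well above it, since
  \<open>X_i / mu_i\<close> has a fixed law, and it uses up \<open>\<theta>^p\<close> of the budget.
  As \<open>p < 2\<close>, the loss per unit of budget grows like \<open>\<theta>^(2-p)\<close> up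
  to the critical height. The spike of the lower bound sits at the same height up to terms of lower
  order, so even the constants agree. Why Bayes risks are needed for the limit in \<open>n\<close>:
  an estimator may use all coordinates, and the least favourable parameter of one block depends on
  the estimator, so superadditivity is not visible from an INF of SUPs. Against a product prior, the
  other block is only independent noise.\<close>

lemma square_pos_part_add_le:
  fixes a b :: real
  shows "(max 0 (a + b))\<^sup>2 \<le> (max 0 a)\<^sup>2 + 2 * max 0 a * b + b\<^sup>2"
proof -
  have "(max 0 (a + b))\<^sup>2 \<le> (max 0 a + b)\<^sup>2"
    by (rule abs_le_square_iff[THEN iffD1]) (auto simp: max_def)
  then show ?thesis by (simp add: power2_sum algebra_simps)
qed

text \<open>The weights of the next best response are proportional to the positive parts of the accumulated
  excess losses; then the cross term in the growth of the potential is nonpositive.\<close>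

lemma blackwell_approachability:
  fixes r :: "'d \<Rightarrow> 'g \<Rightarrow> real"
  assumes G: "finite G" "G \<noteq> {}"
    and bnd: "\<And>d g. d \<in> D \<Longrightarrow> g \<in> G \<Longrightarrow> \<bar>r d g - c\<bar> \<le> B"
    and resp: "\<And>w. (\<And>g. g \<in> G \<Longrightarrow> 0 \<le> w g) \<Longrightarrow> (\<Sum>g\<in>G. w g) = 1 \<Longrightarrow> \<exists>d\<in>D. (\<Sum>g\<in>G. w g * r d g) \<le> c"
  shows "\<exists>ds. (\<forall>t<T. ds t \<in> D) \<and>
           (\<Sum>g\<in>G. (max 0 (\<Sum>t<T. r (ds t) g - c))\<^sup>2) \<le> real T * (real (card G) * B\<^sup>2)"
proof (induction T)
  case 0
  then show ?case by simp
next
  case (Suc T)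
  then obtain ds where ds: "\<And>t. t < T \<Longrightarrow> ds t \<in> D"
    and pot: "(\<Sum>g\<in>G. (max 0 (\<Sum>t<T. r (ds t) g - c))\<^sup>2) \<le> real T * (real (card G) * B\<^sup>2)"
    by blast
  define S where "S g = (\<Sum>t<T. r (ds t) g - c)" for g
  define Z where "Z = (\<Sum>g\<in>G. max 0 (S g))"
  have Z0: "0 \<le> Z" unfolding Z_def by (intro sum_nonneg) auto
  have "\<exists>d\<in>D. (\<Sum>g\<in>G. max 0 (S g) * (r d g - c)) \<le> 0"
  proof (cases "Z = 0")
    case True
    then have "max 0 (S g) = 0" if "g \<in> G" for g
      using that G unfolding Z_def by (subst (asm) sum_nonneg_eq_0_iff) auto
    \<comment> \<open>With no positive excess the cross term vanishes for every rule. The uniform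
      weights serve only to show that \<open>D\<close> is nonempty.\<close>
    moreover obtain d where "d \<in> D"
      using resp[of "\<lambda>_. 1 / real (card G)"] G by auto
    ultimately show ?thesis by (intro bexI[of _ d]) auto
  next
    case False
    with Z0 have Z: "Z > 0" by simp
    have "(\<Sum>g\<in>G. max 0 (S g) / Z) = 1"
      using Z by (simp add: sum_divide_distrib[symmetric] Z_def[symmetric])
    then obtain d where d: "d \<in> D" "(\<Sum>g\<in>G. max 0 (S g) / Z * r d g) \<le> c"
      using resp[of "\<lambda>g. max 0 (S g) / Z"] Z by auto
    have "(\<Sum>g\<in>G. max 0 (S g) * (r d g - c)) = Z * (\<Sum>g\<in>G. max 0 (S g) / Z * r d g) - Z * c"
      using Z by (simp add: algebra_simps sum_subtractf sum_distrib_left Z_def[symmetric])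
        (simp add: Z_def sum_distrib_left mult.commute)
    also have "\<dots> \<le> 0" using d Z by (simp add: mult_left_mono)
    finally show ?thesis using d by blast
  qed
  then obtain d where d: "d \<in> D" "(\<Sum>g\<in>G. max 0 (S g) * (r d g - c)) \<le> 0" by blast
  define ds' where "ds' = ds(T := d)"
  have S': "(\<Sum>t<Suc T. r (ds' t) g - c) = S g + (r d g - c)" for g
    unfolding S_def ds'_def by simp
  have "(\<Sum>g\<in>G. (max 0 (S g + (r d g - c)))\<^sup>2)
      \<le> (\<Sum>g\<in>G. (max 0 (S g))\<^sup>2 + 2 * (max 0 (S g) * (r d g - c)) + B\<^sup>2)"
  proof (intro sum_mono)
    fix g assume g: "g \<in> G"
    have "(r d g - c)\<^sup>2 \<le> B\<^sup>2"
      using bnd[OF d(1) g] by (intro abs_le_square_iff[THEN iffD1]) auto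
    then show "(max 0 (S g + (r d g - c)))\<^sup>2 \<le> (max 0 (S g))\<^sup>2 + 2 * (max 0 (S g) * (r d g - c)) + B\<^sup>2"
      using square_pos_part_add_le[of "S g" "r d g - c"] by (simp add: mult.assoc)
  qed
  also have "\<dots> \<le> real (Suc T) * (real (card G) * B\<^sup>2)"
    using pot d(2) unfolding sum.distrib sum_distrib_left[symmetric] S_def[symmetric]
    by (simp add: distrib_right)
  finally have "(\<Sum>g\<in>G. (max 0 (\<Sum>t<Suc T. r (ds' t) g - c))\<^sup>2) \<le> real (Suc T) * (real (card G) * B\<^sup>2)"
    unfolding S' .
  moreover have "\<forall>t<Suc T. ds' t \<in> D" using ds d(1) by (auto simp: ds'_def less_Suc_eq)
  ultimately show ?case by blast
qed

text \<open>The potential of the approachability argument grows at most linearly in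
  \<open>T\<close>, so every accumulated excess is of order \<open>sqrt T\<close> and the average
  excess is at most \<open>\<epsilon>\<close> once \<open>T \<ge> C / \<epsilon>\<^sup>2\<close>.
  The hypothesis \<open>avg\<close> stands in for convexity: it turns the sequence of best responses
  into a single rule.\<close>

lemma finite_minimax:
  fixes r :: "'d \<Rightarrow> 'g \<Rightarrow> real"
  assumes G: "finite G" "G \<noteq> {}"
    and bnd: "\<And>d g. d \<in> D \<Longrightarrow> g \<in> G \<Longrightarrow> \<bar>r d g\<bar> \<le> B"
    and avg: "\<And>T ds. T > 0 \<Longrightarrow> (\<And>t. t < T \<Longrightarrow> ds t \<in> D) \<Longrightarrow>
               \<exists>d\<in>D. \<forall>g\<in>G. r d g \<le> (\<Sum>t<T. r (ds t) g) / real T"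
    and resp: "\<And>w. (\<And>g. g \<in> G \<Longrightarrow> 0 \<le> w g) \<Longrightarrow> (\<Sum>g\<in>G. w g) = 1 \<Longrightarrow> \<exists>d\<in>D. (\<Sum>g\<in>G. w g * r d g) \<le> c"
    and \<epsilon>: "\<epsilon> > 0"
  shows "\<exists>d\<in>D. \<forall>g\<in>G. r d g \<le> c + \<epsilon>"
proof -
  define C where "C = real (card G) * (B + \<bar>c\<bar>)\<^sup>2"
  obtain T :: nat where "max 1 (C / \<epsilon>\<^sup>2) \<le> real T" using real_arch_simple by blast
  then have T: "T > 0" "real T \<ge> C / \<epsilon>\<^sup>2" by auto
  have bnd': "\<bar>r d g - c\<bar> \<le> B + \<bar>c\<bar>" if "d \<in> D" "g \<in> G" for d g
    using bnd[OF that] by linarith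
  have "\<exists>ds. (\<forall>t<T. ds t \<in> D) \<and> (\<Sum>g\<in>G. (max 0 (\<Sum>t<T. r (ds t) g - c))\<^sup>2) \<le> real T * C"
    unfolding C_def by (rule blackwell_approachability[OF G bnd' resp])
  then obtain ds where ds: "\<forall>t<T. ds t \<in> D"
    and pot: "(\<Sum>g\<in>G. (max 0 (\<Sum>t<T. r (ds t) g - c))\<^sup>2) \<le> real T * C"
    by (elim exE conjE)
  have "\<exists>d\<in>D. \<forall>g\<in>G. r d g \<le> (\<Sum>t<T. r (ds t) g) / real T"
    using ds by (intro avg T(1)) simp
  then obtain d where d: "d \<in> D" "\<And>g. g \<in> G \<Longrightarrow> r d g \<le> (\<Sum>t<T. r (ds t) g) / real T"
    by auto
  have "r d g \<le> c + \<epsilon>" if g: "g \<in> G" for g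
  proof -
    define s where "s = (\<Sum>t<T. r (ds t) g - c)"
    have "(max 0 s)\<^sup>2 \<le> (\<Sum>g\<in>G. (max 0 (\<Sum>t<T. r (ds t) g - c))\<^sup>2)"
      unfolding s_def using G g by (intro member_le_sum) auto
    also have "\<dots> \<le> real T * C" by (rule pot)
    also have "\<dots> \<le> real T * (real T * \<epsilon>\<^sup>2)"
      using T \<epsilon> by (intro mult_left_mono) (auto simp: field_simps)
    finally have "(max 0 s)\<^sup>2 \<le> (real T * \<epsilon>)\<^sup>2" by (simp add: power2_eq_square algebra_simps)
    then have "max 0 s \<le> real T * \<epsilon>" by (rule power2_le_imp_le) (use \<epsilon> in simp)
    then have "(\<Sum>t<T. r (ds t) g) \<le> real T * (c + \<epsilon>)" by (simp add: s_def sum_subtractf algebra_simps)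
    then have "(\<Sum>t<T. r (ds t) g) / real T \<le> c + \<epsilon>" using T by (simp add: field_simps)
    with d(2)[OF g] show ?thesis by linarith
  qed
  with d show ?thesis by blast
qed

subsection \<open>Exponential laws and their products\<close>

definition exp_law :: "real \<Rightarrow> real measure" where
  "exp_law \<mu> = density lborel (exponential_density (1 / \<mu>))"

lemma data_law_eq: "data_law n mu = PiM {..<n} (\<lambda>i. exp_law (mu i))"
  by (simp add: data_law_def exp_law_def)

lemma sets_exp_law [simp, measurable_cong]: "sets (exp_law \<mu>) = sets borel"
  by (simp add: exp_law_def)

lemma space_exp_law [simp]: "space (exp_law \<mu>) = UNIV"
  by (simp add: exp_law_def)

lemma sets_data_law [simp, measurable_cong]: "sets (data_law n mu) = sets (PiM {..<n} (\<lambda>_. lborel))"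
  unfolding data_law_eq by (intro sets_PiM_cong) auto

lemma space_data_law [simp]: "space (data_law n mu) = space (PiM {..<n} (\<lambda>_. lborel))"
  by (rule sets_eq_imp_space_eq) simp

lemma prob_space_exp_law: "\<mu> > 0 \<Longrightarrow> prob_space (exp_law \<mu>)"
  unfolding exp_law_def by (intro prob_space_exponential_density) simp

lemma sigma_finite_exp_law: "sigma_finite_measure (exp_law \<mu>)"
  unfolding exp_law_def by (subst sigma_finite_measure.sigma_finite_iff_density_finite'[OF sigma_finite_lborel]) auto

lemma product_sigma_finite_exp_law: "product_sigma_finite (\<lambda>i. exp_law (mu i))"
  by (simp add: product_sigma_finite_def sigma_finite_exp_law)

lemma prob_space_data_law: "(\<And>i. i < n \<Longrightarrow> mu i > 0) \<Longrightarrow> prob_space (data_law n mu)"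
  unfolding data_law_eq by (intro prob_space_PiM prob_space_exp_law) auto

lemma nn_integral_exp_law:
  assumes [measurable]: "h \<in> borel_measurable borel"
  shows "(\<integral>\<^sup>+x. h x \<partial>exp_law \<mu>) = (\<integral>\<^sup>+x. ennreal (exponential_density (1 / \<mu>) x) * h x \<partial>lborel)"
  unfolding exp_law_def by (subst nn_integral_density) auto

lemma nn_integral_exp_law_scale:
  assumes [measurable]: "h \<in> borel_measurable borel" and c: "c > 0"
  shows "(\<integral>\<^sup>+x. h x \<partial>exp_law (c * \<mu>)) = (\<integral>\<^sup>+x. h (c * x) \<partial>exp_law \<mu>)"
proof -
  have "(\<integral>\<^sup>+x. h x \<partial>exp_law (c * \<mu>))
      = ennreal \<bar>c\<bar> * (\<integral>\<^sup>+x. ennreal (exponential_density (1 / (c * \<mu>)) (0 + c * x)) * h (0 + c * x) \<partial>lborel)"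
    using c by (subst nn_integral_exp_law, simp, subst nn_integral_real_affine[where c = c and t = 0]) auto
  also have "\<dots> = (\<integral>\<^sup>+x. ennreal \<bar>c\<bar> * (ennreal (exponential_density (1 / (c * \<mu>)) (c * x)) * h (c * x)) \<partial>lborel)"
    by (subst nn_integral_cmult) auto
  also have "\<dots> = (\<integral>\<^sup>+x. ennreal (exponential_density (1 / \<mu>) x) * h (c * x) \<partial>lborel)"
  proof (intro nn_integral_cong)
    fix x :: real
    have "\<bar>c\<bar> * exponential_density (1 / (c * \<mu>)) (c * x) = exponential_density (1 / \<mu>) x"
      using c by (auto simp: exponential_density_def mult_less_0_iff)
    then show "ennreal \<bar>c\<bar> * (ennreal (exponential_density (1 / (c * \<mu>)) (c * x)) * h (c * x))
        = ennreal (exponential_density (1 / \<mu>) x) * h (c * x)"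
      by (metis mult.assoc ennreal_mult' abs_ge_zero)
  qed
  also have "\<dots> = (\<integral>\<^sup>+x. h (c * x) \<partial>exp_law \<mu>)"
    by (subst nn_integral_exp_law) auto
  finally show ?thesis .
qed

text \<open>A pointwise comparison of densities, needed only on \<open>x \<ge> 0\<close> because
  both vanish elsewhere. The weight \<open>q\<close> will be either 1 or the indicator of a
  truncation.\<close>

lemma nn_integral_exp_law_dominated:
  assumes [measurable]: "h \<in> borel_measurable borel" "q \<in> borel_measurable borel"
    and le: "\<And>x. x \<ge> 0 \<Longrightarrow> ennreal (1 / a * exp (- x / a)) * q x \<le> ennreal C * ennreal (1 / b * exp (- x / b))"
  shows "(\<integral>\<^sup>+x. h x * q x \<partial>exp_law a) \<le> ennreal C * (\<integral>\<^sup>+x. h x \<partial>exp_law b)"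
proof -
  have "(\<integral>\<^sup>+x. h x * q x \<partial>exp_law a) = (\<integral>\<^sup>+x. ennreal (exponential_density (1 / a) x) * (h x * q x) \<partial>lborel)"
    by (subst nn_integral_exp_law) auto
  also have "\<dots> \<le> (\<integral>\<^sup>+x. ennreal C * (ennreal (exponential_density (1 / b) x) * h x) \<partial>lborel)"
  proof (intro nn_integral_mono)
    fix x :: real
    have "ennreal (exponential_density (1 / a) x) * q x \<le> ennreal C * ennreal (exponential_density (1 / b) x)"
      using le[of x] by (auto simp: exponential_density_def)
    then have "ennreal (exponential_density (1 / a) x) * q x * h x \<le> ennreal C * ennreal (exponential_density (1 / b) x) * h x"
      by (intro mult_right_mono) auto
    then show "ennreal (exponential_density (1 / a) x) * (h x * q x) \<le> ennreal C * (ennreal (exponential_density (1 / b) x) * h x)"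
      by (simp add: mult_ac)
  qed
  also have "\<dots> = ennreal C * (\<integral>\<^sup>+x. h x \<partial>exp_law b)"
    by (subst nn_integral_cmult, simp, subst nn_integral_exp_law) auto
  finally show ?thesis .
qed

text \<open>The smaller mean has the lighter tail, so the density ratio is largest at 0, where it
  equals \<open>b / a\<close>. In the opposite direction the ratio is unbounded for
  \<open>a < b\<close>, which is why rescaling or truncation is needed elsewhere.\<close>

lemma nn_integral_exp_law_le_larger_mean:
  assumes [measurable]: "h \<in> borel_measurable borel" and "0 < a" "a \<le> b"
  shows "(\<integral>\<^sup>+x. h x \<partial>exp_law a) \<le> ennreal (b / a) * (\<integral>\<^sup>+x. h x \<partial>exp_law b)"
proof -
  have "1 / a * exp (- x / a) \<le> b / a * (1 / b * exp (- x / b))" if "x \<ge> 0" for x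
    using assms that by (auto simp: field_simps intro!: mult_left_mono mult_right_mono)
  then have "(\<integral>\<^sup>+x. h x * 1 \<partial>exp_law a) \<le> ennreal (b / a) * (\<integral>\<^sup>+x. h x \<partial>exp_law b)"
    using assms by (intro nn_integral_exp_law_dominated)
      (auto simp: ennreal_mult'[symmetric] simp del: times_divide_eq_left times_divide_eq_right intro!: ennreal_leI)
  then show ?thesis by simp
qed

text \<open>For \<open>0 \<le> x \<le> s\<close> one has
  \<open>exp (- x / a) \<le> 1 \<le> exp (s - x)\<close>. This is the replacement for a likelihood
  ratio bound when the mean \<open>a\<close> exceeds 1.\<close>

lemma nn_integral_exp_law_truncated_le:
  assumes [measurable]: "h \<in> borel_measurable borel" and "a > 0"
  shows "(\<integral>\<^sup>+x. h x * indicator {..s} x \<partial>exp_law a) \<le> ennreal (exp s / a) * (\<integral>\<^sup>+x. h x \<partial>exp_law 1)"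
proof (rule nn_integral_exp_law_dominated)
  fix x :: real assume "x \<ge> 0"
  have "1 / a * exp (- x / a) \<le> exp s / a * (1 / 1 * exp (- x / 1))" if "x \<le> s"
  proof -
    have "exp (- x / a) \<le> exp (s - x)" using that \<open>x \<ge> 0\<close> \<open>a > 0\<close> 
      by (intro exp_le_cancel_iff[THEN iffD2]) (metis diff_ge_0_iff_ge divide_nonneg_pos minus_divide_left neg_le_0_iff_le order_trans)
    then show ?thesis using \<open>a > 0\<close> by (simp add: field_simps exp_diff exp_minus)
  qed
  then show "ennreal (1 / a * exp (- x / a)) * indicator {..s} x \<le> ennreal (exp s / a) * ennreal (1 / 1 * exp (- x / 1))"
    using \<open>a > 0\<close> by (auto simp: indicator_def ennreal_mult'[symmetric] intro!: ennreal_leI)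
qed auto

text \<open>The weights \<open>q i\<close> allow for truncation, the maps \<open>\<phi> i\<close> for a change of scale of the coordinates.\<close>

lemma nn_integral_PiM_dominated:
  fixes f :: "('i \<Rightarrow> 'b) \<Rightarrow> ennreal"
  assumes M: "product_sigma_finite M" and N: "product_sigma_finite N" and I: "finite I"
    and \<phi>[measurable]: "\<And>i. i \<in> I \<Longrightarrow> \<phi> i \<in> measurable (M i) (N i)"
    and q[measurable]: "\<And>i. i \<in> I \<Longrightarrow> q i \<in> borel_measurable (M i)"
    and dom: "\<And>i h. i \<in> I \<Longrightarrow> h \<in> borel_measurable (N i) \<Longrightarrow>
                (\<integral>\<^sup>+x. h (\<phi> i x) * q i x \<partial>M i) \<le> c i * (\<integral>\<^sup>+x. h x \<partial>N i)"
    and f: "f \<in> borel_measurable (PiM I N)"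
  shows "(\<integral>\<^sup>+x. f (\<lambda>i\<in>I. \<phi> i (x i)) * (\<Prod>i\<in>I. q i (x i)) \<partial>PiM I M) \<le> (\<Prod>i\<in>I. c i) * (\<integral>\<^sup>+x. f x \<partial>PiM I N)"
  using I \<phi> q dom f
proof (induction I arbitrary: f rule: finite_induct)
  case empty
  interpret M: product_sigma_finite M by fact
  interpret N: product_sigma_finite N by fact
  show ?case by (simp add: PiM_empty nn_integral_count_space_finite restrict_def)
next
  case (insert i I)
  interpret M: product_sigma_finite M by fact
  interpret N: product_sigma_finite N by fact
  interpret Ni: sigma_finite_measure "N i" by (rule N.sigma_finite_measures)
  note [measurable] = insert.prems(1,2,4)
  have [measurable]: "\<phi> i \<in> measurable (M i) (N i)" "q i \<in> borel_measurable (M i)"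
    using insert.prems(1,2) by auto
  have meas_\<phi>[measurable]: "(\<lambda>x. \<lambda>k\<in>J. \<phi> k (x k)) \<in> measurable (PiM J M) (PiM J N)" if "J \<subseteq> insert i I" for J
    using that insert.prems(1) by (intro measurable_restrict measurable_compose[OF measurable_component_singleton]) auto
  have [measurable]: "(\<lambda>x. \<Prod>k\<in>J. q k (x k)) \<in> borel_measurable (PiM J M)" if "J \<subseteq> insert i I" for J
    using that insert.prems(2) by (intro borel_measurable_prod_ennreal measurable_compose[OF measurable_component_singleton]) auto
  \<comment> \<open>With the new coordinate integrated out under \<open>N i\<close>, the
    one-coordinate bound \<open>dom\<close> at \<open>i\<close> leaves an instance of the induction
    hypothesis with \<open>F\<close> in place of \<open>f\<close>.\<close>
  define F where "F z = (\<integral>\<^sup>+y. f (z(i := y)) \<partial>N i)" for z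
  have F[measurable]: "F \<in> borel_measurable (PiM I N)"
    unfolding F_def by measurable
  have "(\<integral>\<^sup>+x. f (\<lambda>k\<in>insert i I. \<phi> k (x k)) * (\<Prod>k\<in>insert i I. q k (x k)) \<partial>PiM (insert i I) M)
      = (\<integral>\<^sup>+x. (\<integral>\<^sup>+y. f (\<lambda>k\<in>insert i I. \<phi> k ((x(i := y)) k)) * (\<Prod>k\<in>insert i I. q k ((x(i := y)) k)) \<partial>M i) \<partial>PiM I M)"
    using insert.hyps by (subst M.product_nn_integral_insert) auto
  also have "\<dots> \<le> (\<integral>\<^sup>+x. c i * (F (\<lambda>k\<in>I. \<phi> k (x k)) * (\<Prod>k\<in>I. q k (x k))) \<partial>PiM I M)"
  proof (intro nn_integral_mono)
    fix x assume x: "x \<in> space (PiM I M)"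
    define z where "z = (\<lambda>k\<in>I. \<phi> k (x k))"
    define Q where "Q = (\<Prod>k\<in>I. q k (x k))"
    have z: "z \<in> space (PiM I N)"
      unfolding z_def by (rule measurable_space[OF meas_\<phi> x]) auto
    have [measurable]: "(\<lambda>y. f (z(i := y))) \<in> borel_measurable (N i)"
      by (rule measurable_compose[OF measurable_component_update[OF z insert.hyps(2)] insert.prems(4)])
    have 1: "(\<lambda>k\<in>insert i I. \<phi> k ((x(i := y)) k)) = z(i := \<phi> i y)" for y
      using insert.hyps(2) by (auto simp: z_def fun_eq_iff)
    have 2: "(\<Prod>k\<in>insert i I. q k ((x(i := y)) k)) = q i y * Q" for y
    proof -
      have "(\<Prod>k\<in>I. q k ((x(i := y)) k)) = Q"
        unfolding Q_def using insert.hyps by (intro prod.cong) auto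
      then show ?thesis using insert.hyps by (subst prod.insert) auto
    qed
    have "(\<integral>\<^sup>+y. f (z(i := \<phi> i y)) * (q i y * Q) \<partial>M i) = (\<integral>\<^sup>+y. f (z(i := \<phi> i y)) * q i y \<partial>M i) * Q"
      by (simp add: mult.assoc[symmetric]) (rule nn_integral_multc, measurable)
    also have "\<dots> \<le> (c i * F z) * Q"
      using insert.prems(3)[of i "\<lambda>y. f (z(i := y))"] unfolding F_def by (intro mult_right_mono) auto
    finally show "(\<integral>\<^sup>+y. f (\<lambda>k\<in>insert i I. \<phi> k ((x(i := y)) k)) * (\<Prod>k\<in>insert i I. q k ((x(i := y)) k)) \<partial>M i)
        \<le> c i * (F z * Q)"
      unfolding 1 2 by (simp add: mult.assoc)
  qed
  also have "\<dots> = c i * (\<integral>\<^sup>+x. F (\<lambda>k\<in>I. \<phi> k (x k)) * (\<Prod>k\<in>I. q k (x k)) \<partial>PiM I M)"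
    by (subst nn_integral_cmult) auto
  also have "\<dots> \<le> c i * ((\<Prod>k\<in>I. c k) * (\<integral>\<^sup>+x. F x \<partial>PiM I N))"
    using insert.prems by (intro mult_left_mono insert.IH F) auto
  also have "\<dots> = (\<Prod>k\<in>insert i I. c k) * (\<integral>\<^sup>+x. f x \<partial>PiM (insert i I) N)"
    using insert.hyps by (subst N.product_nn_integral_insert) (auto simp: F_def[abs_def] mult.assoc)
  finally show ?case .
qed

section \<open>Concatenation of two independent blocks of observations\<close>

definition append_at :: "nat \<Rightarrow> (nat \<Rightarrow> 'a) \<Rightarrow> (nat \<Rightarrow> 'a) \<Rightarrow> nat \<Rightarrow> 'a" where
  "append_at n x y = (\<lambda>i. if i < n then x i else y (i - n))"

text \<open>Points of a product space are undefined outside the index set, whereas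
  \<open>append_at\<close> carries values there; hence the \<open>restrict\<close> whenever
  concatenated data are fed to an estimator.\<close>

lemma measurable_append_at [measurable]:
  "(\<lambda>(x, y). restrict (append_at n x y) {..<n + m}) \<in>
     measurable (PiM {..<n} (\<lambda>_. lborel) \<Otimes>\<^sub>M PiM {..<m} (\<lambda>_. lborel)) (PiM {..<n + m} (\<lambda>_. lborel :: real measure))"
  unfolding append_at_def case_prod_beta
proof (intro measurable_restrict)
  fix i assume i: "i \<in> {..<n+m}"
  show "(\<lambda>x. if i < n then fst x i else snd x (i - n)) \<in>
     measurable (PiM {..<n} (\<lambda>_. lborel) \<Otimes>\<^sub>M PiM {..<m} (\<lambda>_. lborel)) (lborel :: real measure)"
    using i by (cases "i < n") (auto intro!: measurable_compose[OF measurable_fst] measurable_compose[OF measurable_snd] measurable_component_singleton)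
qed

lemma nn_integral_data_law_append:
  assumes f[measurable]: "f \<in> borel_measurable (PiM {..<n + m} (\<lambda>_. lborel))"
    and h: "\<And>i. i < m \<Longrightarrow> h i > 0"
  shows "(\<integral>\<^sup>+x. f x \<partial>data_law (n + m) (append_at n g h))
       = (\<integral>\<^sup>+x. (\<integral>\<^sup>+y. f (restrict (append_at n x y) {..<n + m}) \<partial>data_law m h) \<partial>data_law n g)"
proof -
  define M where "M i = exp_law (append_at n g h i)" for i
  interpret M: product_sigma_finite M unfolding M_def by (rule product_sigma_finite_exp_law)
  have U: "{..<n + m} = {..<n} \<union> {n..<n + m}" by auto
  have f': "f \<in> borel_measurable (PiM ({..<n} \<union> {n..<n + m}) M)"
  proof -
    have "sets (PiM ({..<n} \<union> {n..<n + m}) M) = sets (PiM {..<n + m} (\<lambda>_. lborel))"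
      unfolding U by (intro sets_PiM_cong) (auto simp: M_def)
    from this refl have "borel_measurable (PiM ({..<n} \<union> {n..<n + m}) M) = borel_measurable (PiM {..<n + m} (\<lambda>_. lborel))"
      by (rule measurable_cong_sets)
    with f show ?thesis by blast
  qed
  have P1: "PiM {..<n} M = data_law n g"
    unfolding data_law_eq M_def by (intro PiM_cong) (auto simp: append_at_def)
  have P2: "PiM {n..<n + m} M = PiM {n..<n + m} (\<lambda>i. exp_law (h (i - n)))"
    by (intro PiM_cong) (auto simp: M_def append_at_def)
  \<comment> \<open>Shifting the second block back to the index set \<open>{..<m}\<close> goes
    through a reindexing of product probability spaces; this is where positivity of \<open>h\<close>
    enters.\<close>
  have P3: "distr (data_law m h) (PiM {n..<n + m} (\<lambda>i. exp_law (h (i - n)))) (\<lambda>\<omega>. \<lambda>i\<in>{n..<n + m}. \<omega> (i - n))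
      = PiM {n..<n + m} (\<lambda>i. exp_law (h (i - n)))"
    unfolding data_law_eq
    by (rule distr_PiM_reindex) (auto simp: inj_on_def intro!: prob_space_exp_law h)
  have re: "(\<lambda>\<omega>. \<lambda>i\<in>{n..<n + m}. \<omega> (i - n)) \<in> measurable (data_law m h) (PiM {n..<n + m} (\<lambda>i. exp_law (h (i - n))))"
    unfolding data_law_eq by (intro measurable_restrict measurable_component_singleton) auto
  have "(\<integral>\<^sup>+x. f x \<partial>data_law (n + m) (append_at n g h)) = (\<integral>\<^sup>+x. f x \<partial>PiM ({..<n} \<union> {n..<n + m}) M)"
    unfolding data_law_eq U M_def ..
  also have "\<dots> = (\<integral>\<^sup>+x. (\<integral>\<^sup>+y. f (merge {..<n} {n..<n + m} (x, y)) \<partial>PiM {n..<n + m} M) \<partial>PiM {..<n} M)"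
    by (rule M.product_nn_integral_fold) (use f' in auto)
  also have "\<dots> = (\<integral>\<^sup>+x. (\<integral>\<^sup>+y. f (restrict (append_at n x y) {..<n + m}) \<partial>data_law m h) \<partial>data_law n g)"
    unfolding P1
  proof (intro nn_integral_cong)
    fix x assume x: "x \<in> space (data_law n g)"
    have x': "x \<in> space (PiM {..<n} M)" using x P1 by simp
    have mm: "(\<lambda>y. f (merge {..<n} {n..<n + m} (x, y))) \<in> borel_measurable (PiM {n..<n + m} M)"
      by (rule measurable_compose[OF _ f'], rule measurable_compose[OF measurable_Pair1'[OF x'] measurable_merge])
    have "(\<integral>\<^sup>+y. f (merge {..<n} {n..<n + m} (x, y)) \<partial>PiM {n..<n + m} M)
        = (\<integral>\<^sup>+y. f (merge {..<n} {n..<n + m} (x, \<lambda>i\<in>{n..<n + m}. y (i - n))) \<partial>data_law m h)"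
      unfolding P2 by (subst P3[symmetric], rule nn_integral_distr[OF re]) (use mm in \<open>simp add: P2\<close>)
    also have "\<dots> = (\<integral>\<^sup>+y. f (restrict (append_at n x y) {..<n + m}) \<partial>data_law m h)"
      by (intro nn_integral_cong arg_cong[where f = f]) (auto simp: merge_def append_at_def fun_eq_iff)
    finally show "(\<integral>\<^sup>+y. f (merge {..<n} {n..<n + m} (x, y)) \<partial>PiM {n..<n + m} M)
        = (\<integral>\<^sup>+y. f (restrict (append_at n x y) {..<n + m}) \<partial>data_law m h)" .
  qed
  finally show ?thesis .
qed

lemma sigma_finite_data_law: "sigma_finite_measure (data_law n mu)"
proof -
  interpret product_sigma_finite "\<lambda>i. exp_law (mu i)" by (rule product_sigma_finite_exp_law)
  show ?thesis unfolding data_law_eq by (rule sigma_finite) simp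
qed

lemma nn_integral_data_law_append_rev:
  assumes f[measurable]: "f \<in> borel_measurable (PiM {..<n + m} (\<lambda>_. lborel))"
    and h: "\<And>i. i < m \<Longrightarrow> h i > 0"
  shows "(\<integral>\<^sup>+x. f x \<partial>data_law (n + m) (append_at n g h))
       = (\<integral>\<^sup>+y. (\<integral>\<^sup>+x. f (restrict (append_at n x y) {..<n + m}) \<partial>data_law n g) \<partial>data_law m h)"
proof -
  interpret pair_sigma_finite "data_law n g" "data_law m h"
    by (simp add: pair_sigma_finite_def sigma_finite_data_law)
  have "(\<lambda>x. f ((\<lambda>(x, y). restrict (append_at n x y) {..<n + m}) x)) \<in> borel_measurable (PiM {..<n} (\<lambda>_. lborel) \<Otimes>\<^sub>M PiM {..<m} (\<lambda>_. lborel))"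
    by measurable
  then have "(\<lambda>(x, y). f (restrict (append_at n x y) {..<n + m})) \<in> borel_measurable (data_law n g \<Otimes>\<^sub>M data_law m h)"
    by (simp add: case_prod_beta' cong: measurable_cong_sets sets_pair_measure_cong)
  from Fubini'[OF this] show ?thesis
    using nn_integral_data_law_append[OF assms] by simp
qed

lemma nn_integral_data_law_component:
  assumes [measurable]: "h \<in> borel_measurable borel" and "i < n" "\<And>i. i < n \<Longrightarrow> mu i > 0"
  shows "(\<integral>\<^sup>+x. h (x i) \<partial>data_law n mu) = (\<integral>\<^sup>+x. h x \<partial>exp_law (mu i))"
proof -
  have "(\<integral>\<^sup>+x. h x \<partial>exp_law (mu i)) = (\<integral>\<^sup>+x. h x \<partial>distr (data_law n mu) (exp_law (mu i)) (\<lambda>x. x i))"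
    unfolding data_law_eq using assms by (subst distr_PiM_component) (auto intro: prob_space_exp_law)
  also have "\<dots> = (\<integral>\<^sup>+x. h (x i) \<partial>data_law n mu)"
    unfolding data_law_eq using assms by (intro nn_integral_distr measurable_component_singleton) auto
  finally show ?thesis by simp
qed

subsection \<open>Bayes bounds and superadditivity\<close>

text \<open>Since the loss only involves \<open>ln (est x i)\<close>, positive estimators are replaced by arbitrary real
  estimators of \<open>ln (mu i)\<close>.\<close>

definition log_estimators :: "nat \<Rightarrow> ((nat \<Rightarrow> real) \<Rightarrow> nat \<Rightarrow> real) set" where
  "log_estimators n = {d. \<forall>i<n. (\<lambda>x. d x i) \<in> borel_measurable (PiM {..<n} (\<lambda>_. lborel))}"

definition total_risk :: "nat \<Rightarrow> ((nat \<Rightarrow> real) \<Rightarrow> nat \<Rightarrow> real) \<Rightarrow> (nat \<Rightarrow> real) \<Rightarrow> ennreal" where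
  "total_risk n d mu = (\<integral>\<^sup>+x. ennreal (\<Sum>i<n. (d x i - ln (mu i))\<^sup>2) \<partial>data_law n mu)"

text \<open>The total risk, not its mean over coordinates, is used so that bounds for two blocks
  add. Finite support turns averages over the prior into finite sums, which commute with all
  integrals over the data.\<close>

definition bayes_bound :: "real \<Rightarrow> real \<Rightarrow> nat \<Rightarrow> real \<Rightarrow> bool" where
  "bayes_bound p eta n b \<longleftrightarrow> (\<exists>W. finite (set_pmf W) \<and> set_pmf W \<subseteq> param_space n p eta \<and>
     (\<forall>d\<in>log_estimators n. ennreal b \<le> (\<integral>\<^sup>+g. total_risk n d g \<partial>measure_pmf W)))"

lemma param_space_iff:
  "mu \<in> param_space n p eta \<longleftrightarrow>
     (\<forall>i<n. mu i \<ge> 1) \<and> (\<Sum>i<n. ln (mu i) powr p) \<le> real n * eta powr p"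
  \<comment> \<open>For \<open>n = 0\<close> both sides hold: \<open>1 / real 0\<close> is 0, and
    the sums are empty.\<close>
  by (cases "n = 0") (auto simp: param_space_def field_simps)

lemma measurable_sq_loss [measurable]:
  "d \<in> log_estimators n \<Longrightarrow>
     (\<lambda>x. \<Sum>i<n. (d x i - mu i)\<^sup>2) \<in> borel_measurable (PiM {..<n} (\<lambda>_. lborel))"
  by (intro borel_measurable_sum borel_measurable_power borel_measurable_diff)
    (auto simp: log_estimators_def)

lemma risk_eq_total_risk:
  assumes est: "est \<in> estimators n"
  shows "risk n est mu = ennreal (1 / real n) * total_risk n (\<lambda>x i. ln (est x i)) mu"
    and "(\<lambda>x i. ln (est x i)) \<in> log_estimators n"
proof -
  show d: "(\<lambda>x i. ln (est x i)) \<in> log_estimators n"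
    using est unfolding log_estimators_def estimators_def by auto
  have [measurable]: "(\<lambda>x. \<Sum>i<n. (ln (est x i) - ln (mu i))\<^sup>2) \<in> borel_measurable (data_law n mu)"
    using measurable_sq_loss[OF d, of "\<lambda>i. ln (mu i)"] by (simp cong: measurable_cong_sets)
  show "risk n est mu = ennreal (1 / real n) * total_risk n (\<lambda>x i. ln (est x i)) mu"
    unfolding risk_def total_risk_def
    by (subst nn_integral_cmult[symmetric]) (auto simp: ennreal_mult'[symmetric])
qed

lemma minimax_risk_le:
  assumes d: "d \<in> log_estimators n"
    and le: "\<And>mu. mu \<in> param_space n p eta \<Longrightarrow> total_risk n d mu \<le> ennreal C"
  shows "minimax_risk n p eta \<le> ennreal (C / real n)"
proof -
  define est where "est = (\<lambda>x i. exp (d x i))"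
  have est: "est \<in> estimators n"
    using d unfolding estimators_def log_estimators_def est_def by auto
  have "minimax_risk n p eta \<le> (SUP mu\<in>param_space n p eta. risk n est mu)"
    unfolding minimax_risk_def by (rule INF_lower[OF est])
  also have "\<dots> \<le> ennreal (C / real n)"
  proof (intro SUP_least)
    fix mu assume "mu \<in> param_space n p eta"
    then have "risk n est mu \<le> ennreal (1 / real n) * ennreal C"
      unfolding risk_eq_total_risk(1)[OF est] using le[of mu] by (intro mult_left_mono) (auto simp: est_def)
    also have "\<dots> = ennreal (C / real n)" by (simp add: ennreal_mult'[symmetric])
    finally show "risk n est mu \<le> ennreal (C / real n)" .
  qed
  finally show ?thesis .
qed

lemma minimax_risk_ge:
  assumes "bayes_bound p eta n b"
  shows "ennreal (b / real n) \<le> minimax_risk n p eta"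
  unfolding minimax_risk_def
proof (intro INF_greatest)
  fix est assume est: "est \<in> estimators n"
  define d where "d = (\<lambda>x i. ln (est x i))"
  obtain W where W: "set_pmf W \<subseteq> param_space n p eta"
    "ennreal b \<le> (\<integral>\<^sup>+g. total_risk n d g \<partial>measure_pmf W)"
    using assms risk_eq_total_risk(2)[OF est] unfolding bayes_bound_def d_def by blast
  have "ennreal (b / real n) = ennreal (1 / real n) * ennreal b" by (simp add: ennreal_mult'[symmetric])
  also have "\<dots> \<le> ennreal (1 / real n) * (\<integral>\<^sup>+g. total_risk n d g \<partial>measure_pmf W)"
    using W by (intro mult_left_mono) auto
  also have "\<dots> = (\<integral>\<^sup>+g. risk n est g \<partial>measure_pmf W)"
    unfolding risk_eq_total_risk(1)[OF est] d_def by (subst nn_integral_cmult) auto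
  also have "\<dots> \<le> (\<integral>\<^sup>+g. (SUP mu\<in>param_space n p eta. risk n est mu) \<partial>measure_pmf W)"
    using W by (intro nn_integral_mono_AE) (auto simp: AE_measure_pmf_iff intro!: SUP_upper)
  also have "\<dots> = (SUP mu\<in>param_space n p eta. risk n est mu)"
    by (simp add: measure_pmf.emeasure_space_1[simplified])
  finally show "ennreal (b / real n) \<le> (SUP mu\<in>param_space n p eta. risk n est mu)" .
qed

text \<open>Pads the coordinates left over when a block length does not divide the sample size; the
  all-ones vector spends no budget.\<close>

lemma bayes_bound_0: "bayes_bound p eta n 0"
  unfolding bayes_bound_def
  by (rule exI[of _ "return_pmf (\<lambda>_. 1)"]) (auto simp: param_space_iff)

lemma sum_lessThan_add:
  fixes f :: "nat \<Rightarrow> 'a :: comm_monoid_add"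
  shows "(\<Sum>i<n + m. f i) = (\<Sum>i<n. f i) + (\<Sum>i<m. f (n + i))"
  by (induction m) (auto simp: add.assoc)

text \<open>The budget \<open>n * eta^p\<close> is additive in \<open>n\<close>, so two blocks that
  each respect their own budget respect the joint one. Superadditivity rests on this.\<close>

lemma append_at_param_space:
  assumes "g \<in> param_space n p eta" "h \<in> param_space m p eta"
  shows "append_at n g h \<in> param_space (n + m) p eta"
  using assms unfolding param_space_iff sum_lessThan_add
  by (auto simp: append_at_def distrib_right)

lemma measurable_append_at_section:
  fixes f :: "(nat \<Rightarrow> real) \<Rightarrow> 'b :: topological_space"
  assumes "f \<in> borel_measurable (PiM {..<n + m} (\<lambda>_. lborel))"
  shows "y \<in> space (PiM {..<m} (\<lambda>_. lborel)) \<Longrightarrow>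
           (\<lambda>x. f (restrict (append_at n x y) {..<n + m})) \<in> borel_measurable (PiM {..<n} (\<lambda>_. lborel))"
    and "x \<in> space (PiM {..<n} (\<lambda>_. lborel)) \<Longrightarrow>
           (\<lambda>y. f (restrict (append_at n x y) {..<n + m})) \<in> borel_measurable (PiM {..<m} (\<lambda>_. lborel))"
proof -
  have *: "(\<lambda>z. f (restrict (append_at n (fst z) (snd z)) {..<n + m}))
      \<in> borel_measurable (PiM {..<n} (\<lambda>_. lborel) \<Otimes>\<^sub>M PiM {..<m} (\<lambda>_. lborel))"
    using measurable_compose[OF measurable_append_at assms] by (simp add: case_prod_beta)
  show "y \<in> space (PiM {..<m} (\<lambda>_. lborel)) \<Longrightarrow>
           (\<lambda>x. f (restrict (append_at n x y) {..<n + m})) \<in> borel_measurable (PiM {..<n} (\<lambda>_. lborel))"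
    using measurable_compose[OF measurable_Pair2' *] by simp
  show "x \<in> space (PiM {..<n} (\<lambda>_. lborel)) \<Longrightarrow>
           (\<lambda>y. f (restrict (append_at n x y) {..<n + m})) \<in> borel_measurable (PiM {..<m} (\<lambda>_. lborel))"
    using measurable_compose[OF measurable_Pair1' *] by simp
qed

text \<open>Conditioning on the second block: for each fixed \<open>y\<close> the rule is an
  estimator based on the first block alone, so the assumed bound applies, and averaging over
  \<open>y\<close> preserves it because the law of \<open>y\<close> has mass 1. The parameter
  \<open>h\<close> of that law does not vary with \<open>g\<close>; this is the independence of the
  two priors.\<close>

lemma bayes_append_left:
  assumes F: "\<And>g. g \<in> A \<Longrightarrow> F g \<in> borel_measurable (PiM {..<n + m} (\<lambda>_. lborel))"
    and h: "\<And>i. i < m \<Longrightarrow> h i > 0"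
    and le: "\<And>y. y \<in> space (PiM {..<m} (\<lambda>_. lborel)) \<Longrightarrow>
               a \<le> (\<Sum>g\<in>A. (\<integral>\<^sup>+x. F g (restrict (append_at n x y) {..<n + m}) \<partial>data_law n g) * w g)"
  shows "a \<le> (\<Sum>g\<in>A. (\<integral>\<^sup>+z. F g z \<partial>data_law (n + m) (append_at n g h)) * w g)"
proof -
  interpret H: prob_space "data_law m h" using h by (rule prob_space_data_law)
  have meas: "(\<lambda>y. \<integral>\<^sup>+x. F g (restrict (append_at n x y) {..<n + m}) \<partial>data_law n g) \<in> borel_measurable (data_law m h)"
    if "g \<in> A" for g
  proof -
    interpret G: sigma_finite_measure "data_law n g" by (rule sigma_finite_data_law)
    note [measurable] = F[OF that]
    have "(\<lambda>z. F g ((\<lambda>(x, y). restrict (append_at n x y) {..<n + m}) (snd z, fst z)))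
      \<in> borel_measurable (PiM {..<m} (\<lambda>_. lborel) \<Otimes>\<^sub>M PiM {..<n} (\<lambda>_. lborel))"
      by measurable
    then have "(\<lambda>(y, x). F g (restrict (append_at n x y) {..<n + m})) \<in> borel_measurable (data_law m h \<Otimes>\<^sub>M data_law n g)"
      by (simp add: case_prod_beta' cong: measurable_cong_sets sets_pair_measure_cong)
    then show ?thesis by (rule G.borel_measurable_nn_integral)
  qed
  have "a = (\<integral>\<^sup>+y. a \<partial>data_law m h)" by (simp add: H.emeasure_space_1 del: space_data_law)
  also have "\<dots> \<le> (\<integral>\<^sup>+y. (\<Sum>g\<in>A. (\<integral>\<^sup>+x. F g (restrict (append_at n x y) {..<n + m}) \<partial>data_law n g) * w g) \<partial>data_law m h)"
    by (intro nn_integral_mono le) simp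
  also have "\<dots> = (\<Sum>g\<in>A. (\<integral>\<^sup>+y. (\<integral>\<^sup>+x. F g (restrict (append_at n x y) {..<n + m}) \<partial>data_law n g) \<partial>data_law m h) * w g)"
    using meas by (subst nn_integral_sum) (auto intro!: sum.cong nn_integral_multc)
  also have "\<dots> = (\<Sum>g\<in>A. (\<integral>\<^sup>+z. F g z \<partial>data_law (n + m) (append_at n g h)) * w g)"
    by (intro sum.cong) (auto simp: nn_integral_data_law_append_rev[OF F h])
  finally show ?thesis .
qed

lemma bayes_append_right:
  assumes F: "\<And>h. h \<in> A \<Longrightarrow> F h \<in> borel_measurable (PiM {..<n + m} (\<lambda>_. lborel))"
    and g: "\<And>i. i < n \<Longrightarrow> g i > 0"
    and h: "\<And>h i. h \<in> A \<Longrightarrow> i < m \<Longrightarrow> h i > 0"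
    and le: "\<And>x. x \<in> space (PiM {..<n} (\<lambda>_. lborel)) \<Longrightarrow>
               a \<le> (\<Sum>h\<in>A. (\<integral>\<^sup>+y. F h (restrict (append_at n x y) {..<n + m}) \<partial>data_law m h) * w h)"
  shows "a \<le> (\<Sum>h\<in>A. (\<integral>\<^sup>+z. F h z \<partial>data_law (n + m) (append_at n g h)) * w h)"
proof -
  interpret G: prob_space "data_law n g" using g by (rule prob_space_data_law)
  have meas: "(\<lambda>x. \<integral>\<^sup>+y. F h (restrict (append_at n x y) {..<n + m}) \<partial>data_law m h) \<in> borel_measurable (data_law n g)"
    if "h \<in> A" for h
  proof -
    interpret H: sigma_finite_measure "data_law m h" by (rule sigma_finite_data_law)
    note [measurable] = F[OF that]
    have "(\<lambda>z. F h ((\<lambda>(x, y). restrict (append_at n x y) {..<n + m}) z))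
      \<in> borel_measurable (PiM {..<n} (\<lambda>_. lborel) \<Otimes>\<^sub>M PiM {..<m} (\<lambda>_. lborel))"
      by measurable
    then have "(\<lambda>(x, y). F h (restrict (append_at n x y) {..<n + m})) \<in> borel_measurable (data_law n g \<Otimes>\<^sub>M data_law m h)"
      by (simp add: case_prod_beta' cong: measurable_cong_sets sets_pair_measure_cong)
    then show ?thesis by (rule H.borel_measurable_nn_integral)
  qed
  have "a = (\<integral>\<^sup>+y. a \<partial>data_law n g)" by (simp add: G.emeasure_space_1 del: space_data_law)
  also have "\<dots> \<le> (\<integral>\<^sup>+x. (\<Sum>h\<in>A. (\<integral>\<^sup>+y. F h (restrict (append_at n x y) {..<n + m}) \<partial>data_law m h) * w h) \<partial>data_law n g)"
    by (intro nn_integral_mono le) simp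
  also have "\<dots> = (\<Sum>h\<in>A. (\<integral>\<^sup>+x. (\<integral>\<^sup>+y. F h (restrict (append_at n x y) {..<n + m}) \<partial>data_law m h) \<partial>data_law n g) * w h)"
    using meas by (subst nn_integral_sum) (auto intro!: sum.cong nn_integral_multc)
  also have "\<dots> = (\<Sum>h\<in>A. (\<integral>\<^sup>+z. F h z \<partial>data_law (n + m) (append_at n g h)) * w h)"
    by (intro sum.cong) (auto simp: nn_integral_data_law_append[OF F] h)
  finally show ?thesis .
qed

text \<open>The prior is the product of the two given ones. The loss splits into the part
  \<open>F1\<close> of the first block and the part \<open>F2\<close> of the second; for either part
  the other block acts as external randomisation and cannot lower the Bayes risk.\<close>

lemma bayes_bound_add:
  assumes "bayes_bound p eta n a" "bayes_bound p eta m b" and ab: "0 \<le> a" "0 \<le> b"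
  shows "bayes_bound p eta (n + m) (a + b)"
proof -
  obtain W where W: "finite (set_pmf W)" "set_pmf W \<subseteq> param_space n p eta"
    "\<And>d. d \<in> log_estimators n \<Longrightarrow> ennreal a \<le> (\<integral>\<^sup>+g. total_risk n d g \<partial>measure_pmf W)"
    using assms(1) unfolding bayes_bound_def by blast
  obtain V where V: "finite (set_pmf V)" "set_pmf V \<subseteq> param_space m p eta"
    "\<And>d. d \<in> log_estimators m \<Longrightarrow> ennreal b \<le> (\<integral>\<^sup>+g. total_risk m d g \<partial>measure_pmf V)"
    using assms(2) unfolding bayes_bound_def by blast
  define A where "A = set_pmf W" define B where "B = set_pmf V"
  have pos: "0 < g i" if "g \<in> A" "i < n" for g i
    using W(2) that by (force simp: A_def param_space_iff)
  have pos': "0 < h i" if "h \<in> B" "i < m" for h i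
    using V(2) that by (force simp: B_def param_space_iff)
  define Z where "Z = map_pmf (\<lambda>(g, h). append_at n g h) (pair_pmf W V)"
  have "ennreal (a + b) \<le> (\<integral>\<^sup>+g. total_risk (n + m) d g \<partial>measure_pmf Z)" if d: "d \<in> log_estimators (n + m)" for d
  proof -
    define F1 where "F1 g z = ennreal (\<Sum>i<n. (d z i - ln (g i))\<^sup>2)" for g :: "nat \<Rightarrow> real" and z
    define F2 where "F2 h z = ennreal (\<Sum>i<m. (d z (n + i) - ln (h i))\<^sup>2)" for h :: "nat \<Rightarrow> real" and z
    have dm: "(\<lambda>z. d z i) \<in> borel_measurable (PiM {..<n + m} (\<lambda>_. lborel))" if "i < n + m" for i
      using d that by (auto simp: log_estimators_def)
    have F1: "F1 g \<in> borel_measurable (PiM {..<n + m} (\<lambda>_. lborel))" for g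
      unfolding F1_def using dm by auto
    have F2: "F2 h \<in> borel_measurable (PiM {..<n + m} (\<lambda>_. lborel))" for h
      unfolding F2_def using dm by auto
    have split: "total_risk (n + m) d (append_at n g h)
        = (\<integral>\<^sup>+z. F1 g z \<partial>data_law (n + m) (append_at n g h)) + (\<integral>\<^sup>+z. F2 h z \<partial>data_law (n + m) (append_at n g h))" for g h
    proof -
      have "total_risk (n + m) d (append_at n g h) = (\<integral>\<^sup>+z. F1 g z + F2 h z \<partial>data_law (n + m) (append_at n g h))"
        unfolding total_risk_def sum_lessThan_add F1_def F2_def
        by (intro nn_integral_cong) (auto simp: append_at_def sum_nonneg)
      also have "\<dots> = (\<integral>\<^sup>+z. F1 g z \<partial>data_law (n + m) (append_at n g h)) + (\<integral>\<^sup>+z. F2 h z \<partial>data_law (n + m) (append_at n g h))"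
        using F1[of g] F2[of h] by (intro nn_integral_add) (auto cong: measurable_cong_sets)
      finally show ?thesis .
    qed
    have left: "ennreal a \<le> (\<Sum>g\<in>A. (\<integral>\<^sup>+z. F1 g z \<partial>data_law (n + m) (append_at n g h)) * ennreal (pmf W g))" if "h \<in> B" for h
    proof (rule bayes_append_left[OF F1 pos'[OF that]])
      fix y assume y: "y \<in> space (PiM {..<m} (\<lambda>_. lborel :: real measure))"
      have "(\<lambda>x i. d (restrict (append_at n x y) {..<n + m}) i) \<in> log_estimators n"
        using measurable_append_at_section(1)[OF dm y] by (auto simp: log_estimators_def)
      from W(3)[OF this] show "ennreal a \<le> (\<Sum>g\<in>A. (\<integral>\<^sup>+x. F1 g (restrict (append_at n x y) {..<n + m}) \<partial>data_law n g) * ennreal (pmf W g))"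
        unfolding total_risk_def F1_def A_def by (simp add: nn_integral_measure_pmf_finite[OF W(1)])
    qed
    have right: "ennreal b \<le> (\<Sum>h\<in>B. (\<integral>\<^sup>+z. F2 h z \<partial>data_law (n + m) (append_at n g h)) * ennreal (pmf V h))" if "g \<in> A" for g
    proof (rule bayes_append_right[where A = B and F = F2])
      fix x assume x: "x \<in> space (PiM {..<n} (\<lambda>_. lborel :: real measure))"
      have "(\<lambda>y i. d (restrict (append_at n x y) {..<n + m}) (n + i)) \<in> log_estimators m"
        using measurable_append_at_section(2)[OF dm x] by (auto simp: log_estimators_def)
      from V(3)[OF this] show "ennreal b \<le> (\<Sum>h\<in>B. (\<integral>\<^sup>+y. F2 h (restrict (append_at n x y) {..<n + m}) \<partial>data_law m h) * ennreal (pmf V h))"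
        unfolding total_risk_def F2_def B_def by (simp add: nn_integral_measure_pmf_finite[OF V(1)])
    qed (use F2 pos[OF that] pos' in auto)
    have one: "(\<Sum>g\<in>A. ennreal (pmf W g)) = 1" "(\<Sum>h\<in>B. ennreal (pmf V h)) = 1"
      using W(1) V(1) by (simp_all add: A_def B_def sum_pmf_eq_1)
    have "(\<integral>\<^sup>+g. total_risk (n + m) d g \<partial>measure_pmf Z)
        = (\<Sum>gh\<in>A \<times> B. total_risk (n + m) d (append_at n (fst gh) (snd gh)) * ennreal (pmf (pair_pmf W V) gh))"
      unfolding Z_def using W(1) V(1)
      by (subst nn_integral_map_pmf, subst nn_integral_measure_pmf_finite) (auto simp: A_def B_def case_prod_beta)
    also have "\<dots> = (\<Sum>g\<in>A. \<Sum>h\<in>B. total_risk (n + m) d (append_at n g h) * (ennreal (pmf W g) * ennreal (pmf V h)))"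
      unfolding sum.cartesian_product by (intro sum.cong refl) (auto simp: pmf_pair ennreal_mult)
    \<comment> \<open>The double sum is grouped in two ways: for \<open>F1\<close> the parameter
      \<open>h\<close> is held fixed while \<open>g\<close> is averaged, and for \<open>F2\<close>
      the roles are exchanged.\<close>
    also have "\<dots> = (\<Sum>h\<in>B. (\<Sum>g\<in>A. (\<integral>\<^sup>+z. F1 g z \<partial>data_law (n + m) (append_at n g h)) * ennreal (pmf W g)) * ennreal (pmf V h))
       + (\<Sum>g\<in>A. (\<Sum>h\<in>B. (\<integral>\<^sup>+z. F2 h z \<partial>data_law (n + m) (append_at n g h)) * ennreal (pmf V h)) * ennreal (pmf W g))"
      (is "_ = ?L + ?R")
    proof -
      have "?L = (\<Sum>g\<in>A. \<Sum>h\<in>B. (\<integral>\<^sup>+z. F1 g z \<partial>data_law (n + m) (append_at n g h)) * (ennreal (pmf W g) * ennreal (pmf V h)))"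
        by (subst sum.swap) (simp add: sum_distrib_left sum_distrib_right mult_ac)
      moreover have "?R = (\<Sum>g\<in>A. \<Sum>h\<in>B. (\<integral>\<^sup>+z. F2 h z \<partial>data_law (n + m) (append_at n g h)) * (ennreal (pmf W g) * ennreal (pmf V h)))"
        by (simp add: sum_distrib_left sum_distrib_right mult_ac)
      ultimately show ?thesis by (simp only: split distrib_right sum.distrib)
    qed
    also have "\<dots> \<ge> (\<Sum>h\<in>B. ennreal a * ennreal (pmf V h)) + (\<Sum>g\<in>A. ennreal b * ennreal (pmf W g))"
      using left right by (intro add_mono sum_mono mult_right_mono) auto
    finally show ?thesis
      using ab by (simp add: sum_distrib_left[symmetric] one)
  qed
  moreover have "finite (set_pmf Z)" "set_pmf Z \<subseteq> param_space (n + m) p eta"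
    using W V by (auto simp: Z_def intro!: append_at_param_space)
  ultimately show ?thesis unfolding bayes_bound_def by blast
qed

lemma bayes_bound_mult:
  assumes "bayes_bound p eta n a" "0 \<le> a"
  shows "bayes_bound p eta (k * n) (real k * a)"
proof (induction k)
  case (Suc k)
  with bayes_bound_add[OF assms(1) Suc] assms(2) show ?case by (simp add: distrib_right)
qed (simp add: bayes_bound_0)

subsection \<open>Minimax risk as a supremum of Bayes risks\<close>

lemma sq_average_le:
  fixes a :: "nat \<Rightarrow> real"
  assumes "T > 0"
  shows "((\<Sum>t<T. a t) / real T - b)\<^sup>2 \<le> (\<Sum>t<T. (a t - b)\<^sup>2) / real T"
proof -
  have "(\<Sum>t<T. a t) / real T - b = (\<Sum>t<T. a t - b) / real T"
    using assms by (simp add: sum_subtractf field_simps)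
  then have "((\<Sum>t<T. a t) / real T - b)\<^sup>2 = (\<Sum>t<T. a t - b)\<^sup>2 / (real T)\<^sup>2"
    by (simp add: power_divide)
  also have "\<dots> \<le> (real T * (\<Sum>t<T. (a t - b)\<^sup>2)) / (real T)\<^sup>2"
    using sum_squared_le_sum_of_squares[of "\<lambda>t. a t - b" "{..<T}"]
    by (intro divide_right_mono) (auto simp: mult.commute)
  also have "\<dots> = (\<Sum>t<T. (a t - b)\<^sup>2) / real T"
    using assms by (simp add: power2_eq_square)
  finally show ?thesis .
qed

text \<open>No coordinate can use more than the whole budget. For fixed \<open>n\<close> this bounds
  the parameters on the log scale, which makes the grid finite and the loss of clipped estimators
  bounded.\<close>

lemma ln_le_of_param_space:
  assumes "p > 0" "mu \<in> param_space n p eta" "i < n"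
  shows "ln (mu i) \<le> (real n * eta powr p) powr (1 / p)"
proof -
  have "mu i \<ge> 1" using assms by (auto simp: param_space_iff)
  then have nn: "ln (mu i) \<ge> 0" by simp
  have "ln (mu i) powr p \<le> (\<Sum>i<n. ln (mu i) powr p)"
    using assms by (intro member_le_sum) auto
  also have "\<dots> \<le> real n * eta powr p" using assms by (auto simp: param_space_iff)
  finally have "(ln (mu i) powr p) powr (1 / p) \<le> (real n * eta powr p) powr (1 / p)"
    using assms by (intro powr_mono2) auto
  then show ?thesis using assms nn by (simp add: powr_powr)
qed

section \<open>Transfer from a grid point to nearby means\<close>

lemma data_law_scaled_le:
  assumes f: "f \<in> borel_measurable (PiM {..<n} (\<lambda>_. lborel))"
    and mu: "\<And>i. i < n \<Longrightarrow> 0 < g i \<and> g i \<le> mu i \<and> mu i \<le> exp \<delta> * g i"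
  shows "(\<integral>\<^sup>+x. f (\<lambda>i\<in>{..<n}. exp (-\<delta>) * x i) \<partial>data_law n mu) \<le> ennreal (exp (\<delta> * real n)) * (\<integral>\<^sup>+x. f x \<partial>data_law n g)"
proof -
  have f': "f \<in> borel_measurable (PiM {..<n} (\<lambda>i. exp_law (g i)))"
    using f unfolding data_law_eq[symmetric] by (simp cong: measurable_cong_sets)
  have "(\<integral>\<^sup>+x. f (\<lambda>i\<in>{..<n}. exp (-\<delta>) * x i) * (\<Prod>i<n. 1) \<partial>PiM {..<n} (\<lambda>i. exp_law (mu i)))
      \<le> (\<Prod>i<n. ennreal (exp \<delta>)) * (\<integral>\<^sup>+x. f x \<partial>PiM {..<n} (\<lambda>i. exp_law (g i)))"
  proof (rule nn_integral_PiM_dominated[OF product_sigma_finite_exp_law product_sigma_finite_exp_law _ _ _ _ f'])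
    fix i and h :: "real \<Rightarrow> ennreal" assume i: "i \<in> {..<n}" and "h \<in> borel_measurable (exp_law (g i))"
    then have h[measurable]: "h \<in> borel_measurable borel" by (simp cong: measurable_cong_sets)
    have mi: "0 < mu i" using mu[of i] i by auto
    have "(\<integral>\<^sup>+x. h (exp (-\<delta>) * x) * 1 \<partial>exp_law (mu i)) = (\<integral>\<^sup>+x. h x \<partial>exp_law (exp (-\<delta>) * mu i))"
      by (subst nn_integral_exp_law_scale) auto
    \<comment> \<open>After rescaling the mean is \<open>exp (-\<delta>) * mu i \<le> g i\<close>;
      the resulting factor is at most \<open>exp \<delta>\<close> because
      \<open>g i \<le> mu i\<close>.\<close>
    also have "\<dots> \<le> ennreal (g i / (exp (-\<delta>) * mu i)) * (\<integral>\<^sup>+x. h x \<partial>exp_law (g i))"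
      using mu[of i] i mi by (intro nn_integral_exp_law_le_larger_mean) (auto simp: exp_minus field_simps)
    also have "\<dots> \<le> ennreal (exp \<delta>) * (\<integral>\<^sup>+x. h x \<partial>exp_law (g i))"
      using mu[of i] i mi by (intro mult_right_mono ennreal_leI) (auto simp: exp_minus field_simps)
    finally show "(\<integral>\<^sup>+x. h (exp (-\<delta>) * x) * 1 \<partial>exp_law (mu i)) \<le> ennreal (exp \<delta>) * (\<integral>\<^sup>+x. h x \<partial>exp_law (g i))" .
  qed auto
  then show ?thesis
    unfolding data_law_eq by (simp add: ennreal_power exp_of_nat2_mult[symmetric] mult.commute)
qed

lemma total_risk_rescaled_le:
  assumes d: "d \<in> log_estimators n" and \<delta>: "\<delta> > 0" and r: "r \<ge> 0" "total_risk n d g \<le> ennreal r"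
    and mu: "\<And>i. i < n \<Longrightarrow> 0 < g i \<and> g i \<le> mu i \<and> mu i \<le> exp \<delta> * g i"
  shows "total_risk n (\<lambda>x. d (\<lambda>i\<in>{..<n}. exp (-\<delta>) * x i)) mu
     \<le> ennreal (exp (\<delta> * real n) * ((1 + \<delta>) * r + real n * (\<delta> + \<delta>\<^sup>2)))"
proof -
  define f where "f x = ennreal (\<Sum>i<n. (d x i - ln (mu i))\<^sup>2)" for x
  have f: "f \<in> borel_measurable (PiM {..<n} (\<lambda>_. lborel))"
    unfolding f_def using measurable_sq_loss[OF d, of "\<lambda>i. ln (mu i)"] by simp
  have [measurable]: "(\<lambda>x. \<Sum>i<n. (d x i - ln (g i))\<^sup>2) \<in> borel_measurable (data_law n g)"
    using measurable_sq_loss[OF d, of "\<lambda>i. ln (g i)"] by (simp cong: measurable_cong_sets)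
  interpret P: prob_space "data_law n g" using mu by (intro prob_space_data_law) auto
  have sq: "(d x i - ln (mu i))\<^sup>2 \<le> (1 + \<delta>) * (d x i - ln (g i))\<^sup>2 + (\<delta> + \<delta>\<^sup>2)" if i: "i < n" for x i
  proof -
    define a where "a = d x i - ln (g i)"
    define b where "b = ln (mu i) - ln (g i)"
    have "ln (mu i) \<le> ln (exp \<delta> * g i)" using mu[OF i] by (subst ln_le_cancel_iff) auto
    then have b: "0 \<le> b" "b \<le> \<delta>" using mu[OF i] by (auto simp: b_def ln_mult)
    have "(a - b)\<^sup>2 \<le> (1 + \<delta>) * a\<^sup>2 + (\<delta> + \<delta>\<^sup>2)"
    proof -
      \<comment> \<open>Young's inequality for the cross term \<open>2 * a * b\<close>, weighted so
        that the price \<open>b\<^sup>2 / \<delta>\<close> is at most \<open>\<delta>\<close> while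
        the factor of \<open>a\<^sup>2\<close> stays \<open>1 + \<delta>\<close>.\<close>
      have "0 \<le> \<delta> * (a + b / \<delta>)\<^sup>2" using \<delta> by simp
      also have "\<dots> = \<delta> * a\<^sup>2 + 2 * a * b + b\<^sup>2 / \<delta>"
        using \<delta> by (simp add: power2_eq_square field_simps)
      finally have "- (2 * a * b) \<le> \<delta> * a\<^sup>2 + b\<^sup>2 / \<delta>" by simp
      moreover have b2: "b\<^sup>2 \<le> \<delta>\<^sup>2" using b by (intro power_mono) auto
      moreover have "b\<^sup>2 / \<delta> \<le> \<delta>" using b2 \<delta> by (simp add: power2_eq_square field_simps)
      ultimately show ?thesis by (simp add: power2_diff algebra_simps)
    qed
    then show ?thesis unfolding a_def b_def by simp
  qed
  have "total_risk n (\<lambda>x. d (\<lambda>i\<in>{..<n}. exp (-\<delta>) * x i)) mu \<le> ennreal (exp (\<delta> * real n)) * (\<integral>\<^sup>+x. f x \<partial>data_law n g)"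
    using data_law_scaled_le[OF f mu] unfolding total_risk_def f_def by simp
  also have "\<dots> \<le> ennreal (exp (\<delta> * real n)) * ennreal ((1 + \<delta>) * r + real n * (\<delta> + \<delta>\<^sup>2))"
  proof (intro mult_left_mono)
    have "(\<integral>\<^sup>+x. f x \<partial>data_law n g)
        \<le> (\<integral>\<^sup>+x. ennreal (1 + \<delta>) * ennreal (\<Sum>i<n. (d x i - ln (g i))\<^sup>2) + ennreal (real n * (\<delta> + \<delta>\<^sup>2)) \<partial>data_law n g)"
    proof (intro nn_integral_mono)
      fix x
      have "(\<Sum>i<n. (d x i - ln (mu i))\<^sup>2) \<le> (\<Sum>i<n. (1 + \<delta>) * (d x i - ln (g i))\<^sup>2 + (\<delta> + \<delta>\<^sup>2))"
        by (intro sum_mono sq) auto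
      also have "\<dots> = (1 + \<delta>) * (\<Sum>i<n. (d x i - ln (g i))\<^sup>2) + real n * (\<delta> + \<delta>\<^sup>2)"
        unfolding sum.distrib sum_distrib_left[symmetric] by (simp add: distrib_left)
      finally show "f x \<le> ennreal (1 + \<delta>) * ennreal (\<Sum>i<n. (d x i - ln (g i))\<^sup>2) + ennreal (real n * (\<delta> + \<delta>\<^sup>2))"
        unfolding f_def using \<delta>
        by (subst ennreal_mult'[symmetric], simp, subst ennreal_plus[symmetric]) (auto intro!: ennreal_leI mult_nonneg_nonneg sum_nonneg)
    qed
    also have "\<dots> = ennreal (1 + \<delta>) * total_risk n d g + ennreal (real n * (\<delta> + \<delta>\<^sup>2))"
      unfolding total_risk_def
      by (subst nn_integral_add) (auto simp: nn_integral_cmult P.emeasure_space_1 simp del: space_data_law)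
    also have "\<dots> \<le> ennreal (1 + \<delta>) * ennreal r + ennreal (real n * (\<delta> + \<delta>\<^sup>2))"
      using r by (intro add_right_mono mult_left_mono) auto
    also have "\<dots> = ennreal ((1 + \<delta>) * r + real n * (\<delta> + \<delta>\<^sup>2))"
      using r \<delta> by (simp add: ennreal_mult'[symmetric] ennreal_plus[symmetric] del: ennreal_plus)
    finally show "(\<integral>\<^sup>+x. f x \<partial>data_law n g) \<le> ennreal ((1 + \<delta>) * r + real n * (\<delta> + \<delta>\<^sup>2))" .
  qed auto
  also have "\<dots> = ennreal (exp (\<delta> * real n) * ((1 + \<delta>) * r + real n * (\<delta> + \<delta>\<^sup>2)))"
    by (simp add: ennreal_mult')
  finally show ?thesis .
qed

text \<open>Rounding down keeps the grid inside the parameter space. The law of the data with the larger mean,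
  rescaled by \<open>exp (-\<delta>)\<close>, has a mean below that of the grid point, and a smaller exponential mean
  gives a bounded likelihood ratio.\<close>

lemma exists_finite_grid:
  assumes p: "p > 0" and \<delta>: "\<delta> > 0"
  shows "\<exists>G. finite G \<and> G \<subseteq> param_space n p eta \<and>
    (\<forall>mu\<in>param_space n p eta. \<exists>g\<in>G. \<forall>i<n. g i \<le> mu i \<and> mu i \<le> exp \<delta> * g i)"
proof -
  define A where "A = (real n * eta powr p) powr (1 / p)"
  define N where "N = nat \<lfloor>A / \<delta>\<rfloor>"
  define grid where "grid k = (\<lambda>i. exp (\<delta> * real (k i)))" for k :: "nat \<Rightarrow> nat"
  define G where "G = grid ` (PiE {..<n} (\<lambda>_. {..N})) \<inter> param_space n p eta"
  have "finite G" unfolding G_def by (intro finite_Int disjI1 finite_imageI finite_PiE) auto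
  moreover have "\<exists>g\<in>G. \<forall>i<n. g i \<le> mu i \<and> mu i \<le> exp \<delta> * g i" if mu: "mu \<in> param_space n p eta" for mu
  proof -
    define k where "k = (\<lambda>i\<in>{..<n}. nat \<lfloor>ln (mu i) / \<delta>\<rfloor>)"
    have k: "\<delta> * real (k i) \<le> ln (mu i)" "ln (mu i) \<le> \<delta> + \<delta> * real (k i)" "k i \<le> N" "mu i \<ge> 1" if i: "i < n" for i
    proof -
      show m1: "mu i \<ge> 1" using mu i by (auto simp: param_space_iff)
      then have "0 \<le> ln (mu i) / \<delta>" using \<delta> by simp
      then have kr: "real (k i) = of_int \<lfloor>ln (mu i) / \<delta>\<rfloor>" using i by (simp add: k_def)
      have "real (k i) \<le> ln (mu i) / \<delta>" "ln (mu i) / \<delta> \<le> real (k i) + 1" unfolding kr by linarith+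
      then show "\<delta> * real (k i) \<le> ln (mu i)" "ln (mu i) \<le> \<delta> + \<delta> * real (k i)"
        using \<delta> by (auto simp: field_simps)
      have "ln (mu i) / \<delta> \<le> A / \<delta>"
        using ln_le_of_param_space[OF p mu i] \<delta> by (simp add: A_def divide_right_mono)
      then show "k i \<le> N" using i unfolding N_def k_def by (auto intro!: nat_mono floor_mono)
    qed
    have le: "grid k i \<le> mu i" "1 \<le> grid k i" "mu i \<le> exp \<delta> * grid k i"
      "ln (grid k i) \<le> ln (mu i)" if i: "i < n" for i
    proof -
      show "ln (grid k i) \<le> ln (mu i)" using k(1)[OF i] by (simp add: grid_def)
      have m: "mu i = exp (ln (mu i))" using k(4)[OF i] by simp
      show "grid k i \<le> mu i" unfolding grid_def by (subst m) (use k(1)[OF i] in simp)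
      show "1 \<le> grid k i" using \<delta> by (simp add: grid_def)
      show "mu i \<le> exp \<delta> * grid k i" unfolding grid_def
        by (subst m, subst exp_add[symmetric]) (use k(2)[OF i] in simp)
    qed
    have "(\<Sum>i<n. ln (grid k i) powr p) \<le> (\<Sum>i<n. ln (mu i) powr p)"
      using le p by (intro sum_mono powr_mono2) auto
    then have "grid k \<in> param_space n p eta" using mu le by (auto simp: param_space_iff)
    moreover have "k \<in> PiE {..<n} (\<lambda>_. {..N})" using k(3) by (auto simp: k_def)
    ultimately have "grid k \<in> G" by (auto simp: G_def)
    with le show ?thesis by blast
  qed
  ultimately show ?thesis unfolding G_def by blast
qed

section \<open>The hypotheses of the finite minimax theorem: boundedness, averaging, best
  responses\<close>

lemma total_risk_le_of_bounded:
  assumes "\<And>x i. i < n \<Longrightarrow> 0 \<le> d x i \<and> d x i \<le> A"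
    and "\<And>i. i < n \<Longrightarrow> 0 < g i \<and> 0 \<le> ln (g i) \<and> ln (g i) \<le> A"
  shows "total_risk n d g \<le> ennreal (real n * A\<^sup>2)"
proof -
  interpret P: prob_space "data_law n g" using assms by (intro prob_space_data_law) auto
  have "(\<Sum>i<n. (d x i - ln (g i))\<^sup>2) \<le> (\<Sum>i<n. A\<^sup>2)" for x
    using assms by (intro sum_mono abs_le_square_iff[THEN iffD1]) (smt (verit, best) lessThan_iff)
  then have "total_risk n d g \<le> (\<integral>\<^sup>+x. ennreal (real n * A\<^sup>2) \<partial>data_law n g)"
    unfolding total_risk_def by (intro nn_integral_mono ennreal_leI) simp
  also have "\<dots> = ennreal (real n * A\<^sup>2)"
    by (simp add: P.emeasure_space_1 del: space_data_law)
  finally show ?thesis .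
qed

lemma total_risk_average_le:
  assumes T: "T > 0" and ds: "\<And>t. t < T \<Longrightarrow> ds t \<in> log_estimators n"
  shows "total_risk n (\<lambda>x i. (\<Sum>t<T. ds t x i) / real T) g \<le> ennreal (1 / real T) * (\<Sum>t<T. total_risk n (ds t) g)"
proof -
  have meas: "(\<lambda>x. \<Sum>i<n. (ds t x i - ln (g i))\<^sup>2) \<in> borel_measurable (data_law n g)" if "t < T" for t
    using measurable_sq_loss[OF ds[OF that], of "\<lambda>i. ln (g i)"] by (simp cong: measurable_cong_sets)
  have "total_risk n (\<lambda>x i. (\<Sum>t<T. ds t x i) / real T) g
      \<le> (\<integral>\<^sup>+x. ennreal (1 / real T) * (\<Sum>t<T. ennreal (\<Sum>i<n. (ds t x i - ln (g i))\<^sup>2)) \<partial>data_law n g)"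
    unfolding total_risk_def
  proof (intro nn_integral_mono)
    fix x
    have "(\<Sum>i<n. ((\<Sum>t<T. ds t x i) / real T - ln (g i))\<^sup>2) \<le> (\<Sum>i<n. (\<Sum>t<T. (ds t x i - ln (g i))\<^sup>2) / real T)"
      by (intro sum_mono sq_average_le[OF T])
    also have "\<dots> = 1 / real T * (\<Sum>t<T. \<Sum>i<n. (ds t x i - ln (g i))\<^sup>2)"
      by (subst sum.swap) (simp add: sum_divide_distrib)
    finally show "ennreal (\<Sum>i<n. ((\<Sum>t<T. ds t x i) / real T - ln (g i))\<^sup>2)
        \<le> ennreal (1 / real T) * (\<Sum>t<T. ennreal (\<Sum>i<n. (ds t x i - ln (g i))\<^sup>2))"
      by (subst sum_ennreal, simp add: sum_nonneg, subst ennreal_mult'[symmetric], simp) (rule ennreal_leI)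
  qed
  also have "\<dots> = ennreal (1 / real T) * (\<Sum>t<T. total_risk n (ds t) g)"
    unfolding total_risk_def using meas by (subst nn_integral_cmult, simp, subst nn_integral_sum) auto
  finally show ?thesis .
qed

text \<open>Weights on \<open>G\<close> are a prior with finite support in the parameter space. If
  no such prior forces total risk \<open>b\<close>, each of them is beaten by some
  estimator.\<close>

lemma exists_best_response:
  assumes no: "\<not> bayes_bound p eta n b" and b: "b \<ge> 0"
    and G: "finite G" "G \<subseteq> param_space n p eta"
    and w: "\<And>g. g \<in> G \<Longrightarrow> 0 \<le> w g" "(\<Sum>g\<in>G. w g) = 1"
  shows "\<exists>d\<in>log_estimators n. (\<Sum>g\<in>G. ennreal (w g) * total_risk n d g) \<le> ennreal b"
proof -
  \<comment> \<open>Extension by 0, since the prior has to be a distribution on all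
    functions.\<close>
  define f where "f g = (if g \<in> G then w g else 0)" for g
  define W where "W = embed_pmf f"
  have f0: "\<And>g. 0 \<le> f g" using w by (auto simp: f_def)
  have "(\<integral>\<^sup>+g. ennreal (f g) \<partial>count_space UNIV) = (\<Sum>g\<in>G. ennreal (f g))"
    using G by (intro nn_integral_count_space') (auto simp: f_def)
  also have "\<dots> = ennreal (\<Sum>g\<in>G. f g)" using f0 by (intro sum_ennreal) auto
  also have "\<dots> = 1" using w by (simp add: f_def)
  finally have f1: "(\<integral>\<^sup>+g. ennreal (f g) \<partial>count_space UNIV) = 1" .
  have W: "pmf W g = f g" "set_pmf W = {g. f g \<noteq> 0}" for g
    unfolding W_def using f0 f1 by (auto intro: pmf_embed_pmf simp: set_embed_pmf)
  have sub: "set_pmf W \<subseteq> G" by (auto simp: W f_def)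
  then have "finite (set_pmf W)" "set_pmf W \<subseteq> param_space n p eta" using G finite_subset by auto
  with no obtain d where d: "d \<in> log_estimators n" "\<not> ennreal b \<le> (\<integral>\<^sup>+g. total_risk n d g \<partial>measure_pmf W)"
    unfolding bayes_bound_def by blast
  have "(\<integral>\<^sup>+g. total_risk n d g \<partial>measure_pmf W) = (\<Sum>g\<in>G. total_risk n d g * ennreal (pmf W g))"
    using sub G by (intro nn_integral_measure_pmf_support) auto
  also have "\<dots> = (\<Sum>g\<in>G. ennreal (w g) * total_risk n d g)"
    by (intro sum.cong) (auto simp: W f_def mult.commute)
  finally show ?thesis using d by (intro bexI[of _ d]) auto
qed

text \<open>If no finite prior forces \<open>n * c\<close>, best responses exist for every prior on
  a grid. The finite minimax theorem merges them into one rule that is good at all grid points,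
  rescaling the data makes it good on the whole parameter space, and letting \<open>\<delta>\<close>
  tend to 0 contradicts \<open>less\<close>.\<close>

lemma bayes_bound_if_less_minimax_risk:
  assumes p: "p > 0" and n: "n > 0" and c: "c \<ge> 0" and less: "ennreal c < minimax_risk n p eta"
  shows "bayes_bound p eta n (real n * c)"
proof (rule ccontr)
  assume no: "\<not> bayes_bound p eta n (real n * c)"
  define A where "A = (real n * eta powr p) powr (1 / p)"
  \<comment> \<open>All values \<open>ln (mu i)\<close> lie in \<open>[0, A]\<close>, so clipping a
    rule to this interval never increases its loss, and it gives the uniform bound on risks that
    approachability requires.\<close>
  define D where "D = {d \<in> log_estimators n. \<forall>x. \<forall>i<n. 0 \<le> d x i \<and> d x i \<le> A}"
  have A0: "A \<ge> 0" by (simp add: A_def)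
  have lnA: "0 < g i \<and> 0 \<le> ln (g i) \<and> ln (g i) \<le> A" if "g \<in> param_space n p eta" "i < n" for g i
    using ln_le_of_param_space[OF p that] that by (force simp: A_def param_space_iff)
  have key: "minimax_risk n p eta \<le> ennreal (exp (\<delta> * real n) * ((1 + \<delta>) * (real n * c + \<delta>) + real n * (\<delta> + \<delta>\<^sup>2)) / real n)"
    if \<delta>: "\<delta> > 0" for \<delta>
  proof -
    obtain G where G: "finite G" "G \<subseteq> param_space n p eta"
      and near: "\<And>mu. mu \<in> param_space n p eta \<Longrightarrow> \<exists>g\<in>G. \<forall>i<n. g i \<le> mu i \<and> mu i \<le> exp \<delta> * g i"
      using exists_finite_grid[OF p \<delta>] by metis
    have one: "(\<lambda>_. 1) \<in> param_space n p eta" by (auto simp: param_space_iff)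
    have Gne: "G \<noteq> {}" using near[OF one] by auto
    define r where "r d g = enn2real (total_risk n d g)" for d g
    have fin: "total_risk n d g \<le> ennreal (real n * A\<^sup>2)" if "d \<in> D" "g \<in> G" for d g
      using that lnA G by (intro total_risk_le_of_bounded) (auto simp: D_def)
    have r: "ennreal (r d g) = total_risk n d g" "0 \<le> r d g" "r d g \<le> real n * A\<^sup>2" if "d \<in> D" "g \<in> G" for d g
    proof -
      show "ennreal (r d g) = total_risk n d g"
        unfolding r_def using fin[OF that] by (metis ennreal_enn2real_if ennreal_neq_top neq_top_trans)
      show "0 \<le> r d g" by (simp add: r_def)
      show "r d g \<le> real n * A\<^sup>2" unfolding r_def using fin[OF that] by (intro enn2real_leI) auto
    qed
    have "\<exists>d\<in>D. \<forall>g\<in>G. r d g \<le> real n * c + \<delta>"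
    proof (rule finite_minimax[OF G(1) Gne _ _ _ \<delta>])
      show "\<bar>r d g\<bar> \<le> real n * A\<^sup>2" if "d \<in> D" "g \<in> G" for d g using r[OF that] by simp
    next
      fix T and ds :: "nat \<Rightarrow> (nat \<Rightarrow> real) \<Rightarrow> nat \<Rightarrow> real"
      assume T: "T > 0" and ds: "\<And>t. t < T \<Longrightarrow> ds t \<in> D"
      define d where "d = (\<lambda>x i. (\<Sum>t<T. ds t x i) / real T)"
      have "d \<in> log_estimators n"
        using ds by (auto simp: d_def log_estimators_def D_def intro!: borel_measurable_divide borel_measurable_sum)
      moreover have "0 \<le> d x i \<and> d x i \<le> A" if "i < n" for x i
      proof -
        have "0 \<le> (\<Sum>t<T. ds t x i)" using ds that by (intro sum_nonneg) (auto simp: D_def)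
        moreover have "(\<Sum>t<T. ds t x i) \<le> real T * A"
          using ds that sum_bounded_above[of "{..<T}" "\<lambda>t. ds t x i" A] by (auto simp: D_def)
        ultimately show ?thesis using T by (simp add: d_def field_simps)
      qed
      ultimately have d: "d \<in> D" by (simp add: D_def)
      have "r d g \<le> (\<Sum>t<T. r (ds t) g) / real T" if g: "g \<in> G" for g
      proof -
        have "ennreal (r d g) \<le> ennreal (1 / real T) * (\<Sum>t<T. total_risk n (ds t) g)"
          unfolding r(1)[OF d g] unfolding d_def using ds by (intro total_risk_average_le T) (auto simp: D_def)
        also have "(\<Sum>t<T. total_risk n (ds t) g) = (\<Sum>t<T. ennreal (r (ds t) g))"
          using ds g r(1) by (intro sum.cong) auto
        also have "ennreal (1 / real T) * \<dots> = ennreal ((\<Sum>t<T. r (ds t) g) / real T)"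
          by (subst sum_ennreal) (auto simp: r_def ennreal_mult'[symmetric])
        finally show ?thesis by (subst (asm) ennreal_le_iff) (auto simp: r_def intro!: divide_nonneg_nonneg sum_nonneg)
      qed
      with d show "\<exists>d\<in>D. \<forall>g\<in>G. r d g \<le> (\<Sum>t<T. r (ds t) g) / real T" by blast
    next
      fix w :: "(nat \<Rightarrow> real) \<Rightarrow> real" assume w: "\<And>g. g \<in> G \<Longrightarrow> 0 \<le> w g" "(\<Sum>g\<in>G. w g) = 1"
      obtain d0 where d0: "d0 \<in> log_estimators n" "(\<Sum>g\<in>G. ennreal (w g) * total_risk n d0 g) \<le> ennreal (real n * c)"
        using exists_best_response[OF no _ G w] c by auto
      define d where "d = (\<lambda>x i. max 0 (min A (d0 x i)))"
      have d: "d \<in> D" using d0 A0 by (auto simp: d_def D_def log_estimators_def)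
      have clip: "total_risk n d g \<le> total_risk n d0 g" if "g \<in> G" for g
        unfolding total_risk_def
      proof (intro nn_integral_mono ennreal_leI sum_mono)
        fix x i assume "i \<in> {..<n}"
        then have "0 \<le> ln (g i)" "ln (g i) \<le> A" using lnA[of g i] that G by auto
        then show "(d x i - ln (g i))\<^sup>2 \<le> (d0 x i - ln (g i))\<^sup>2"
          by (intro abs_le_square_iff[THEN iffD1]) (auto simp: d_def)
      qed
      have "ennreal (\<Sum>g\<in>G. w g * r d g) = (\<Sum>g\<in>G. ennreal (w g) * total_risk n d g)"
        using w r[OF d] by (subst sum_ennreal[symmetric]) (auto simp: ennreal_mult intro!: sum.cong)
      also have "\<dots> \<le> (\<Sum>g\<in>G. ennreal (w g) * total_risk n d0 g)"
        using clip by (intro sum_mono mult_left_mono) auto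
      also note d0(2)
      finally have "(\<Sum>g\<in>G. w g * r d g) \<le> real n * c"
        using c by (subst (asm) ennreal_le_iff) auto
      with d show "\<exists>d\<in>D. (\<Sum>g\<in>G. w g * r d g) \<le> real n * c" by blast
    qed
    then obtain d where d: "d \<in> D" "\<And>g. g \<in> G \<Longrightarrow> r d g \<le> real n * c + \<delta>" by blast
    have dl: "d \<in> log_estimators n" using d by (simp add: D_def)
    show ?thesis
    proof (rule minimax_risk_le)
      have "(\<lambda>x. \<lambda>i\<in>{..<n}. exp (-\<delta>) * x i) \<in> measurable (PiM {..<n} (\<lambda>_. lborel)) (PiM {..<n} (\<lambda>_. lborel))"
        by (intro measurable_restrict) auto
      from measurable_compose[OF this] dl
      show "(\<lambda>x. d (\<lambda>i\<in>{..<n}. exp (-\<delta>) * x i)) \<in> log_estimators n"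
        unfolding log_estimators_def by blast
    next
      fix mu assume "mu \<in> param_space n p eta"
      then obtain g where g: "g \<in> G" "\<And>i. i < n \<Longrightarrow> g i \<le> mu i \<and> mu i \<le> exp \<delta> * g i" using near by blast
      have "total_risk n d g \<le> ennreal (real n * c + \<delta>)"
        unfolding r(1)[OF d(1) g(1), symmetric] using d(2)[OF g(1)] by (rule ennreal_leI)
      then show "total_risk n (\<lambda>x. d (\<lambda>i\<in>{..<n}. exp (-\<delta>) * x i)) mu
         \<le> ennreal (exp (\<delta> * real n) * ((1 + \<delta>) * (real n * c + \<delta>) + real n * (\<delta> + \<delta>\<^sup>2)))"
        using g lnA G(2) \<delta> c by (intro total_risk_rescaled_le dl) auto
    qed
  qed
  \<comment> \<open>Here \<open>n\<close> is fixed, so the cost \<open>exp (\<delta> * n)\<close> of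
    changing the likelihood tends to 1 with \<open>\<delta>\<close>.\<close>
  have "((\<lambda>\<delta>. exp (\<delta> * real n) * ((1 + \<delta>) * (real n * c + \<delta>) + real n * (\<delta> + \<delta>\<^sup>2)) / real n)
      \<longlongrightarrow> exp (0 * real n) * ((1 + 0) * (real n * c + 0) + real n * (0 + 0\<^sup>2)) / real n) (at_right 0)"
    using n by (intro tendsto_intros) auto
  then have "((\<lambda>\<delta>. ennreal (exp (\<delta> * real n) * ((1 + \<delta>) * (real n * c + \<delta>) + real n * (\<delta> + \<delta>\<^sup>2)) / real n))
      \<longlongrightarrow> ennreal c) (at_right 0)"
    using n by (intro tendsto_ennrealI) simp
  moreover have "eventually (\<lambda>\<delta>. minimax_risk n p eta \<le> ennreal (exp (\<delta> * real n) * ((1 + \<delta>) * (real n * c + \<delta>) + real n * (\<delta> + \<delta>\<^sup>2)) / real n)) (at_right 0)"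
    using key by (auto simp: eventually_at_right_less eventually_at_filter)
  ultimately have "minimax_risk n p eta \<le> ennreal c"
    by (intro tendsto_lowerbound) auto
  with less show False by simp
qed

text \<open>Fekete's argument: a prior that is good for \<open>n\<close> coordinates is repeated on
  \<open>N div n\<close> blocks, and the remaining \<open>N mod n\<close> coordinates get the
  trivial bound.\<close>

lemma minimax_risk_tendsto_SUP:
  assumes p: "p > 0"
  shows "(\<lambda>n. minimax_risk n p eta) \<longlonglongrightarrow> (SUP n\<in>{0<..}. minimax_risk n p eta)" (is "_ \<longlonglongrightarrow> ?S")
proof (rule order_tendstoI)
  fix a assume "?S < a"
  moreover have "minimax_risk n p eta \<le> ?S" if "n > 0" for n
    using that by (intro SUP_upper) auto
  ultimately show "eventually (\<lambda>n. minimax_risk n p eta < a) sequentially"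
    by (intro eventually_sequentiallyI[of 1]) (metis le_less_trans less_eq_Suc_le One_nat_def)
next
  fix a assume "a < ?S"
  then obtain n where n: "n > 0" "a < minimax_risk n p eta" by (auto simp: less_SUP_iff)
  obtain b where b: "a < b" "b < minimax_risk n p eta" using dense[OF n(2)] by auto
  obtain c where c: "b = ennreal c" "c \<ge> 0" using b(2) by (cases b) auto
  obtain a' where a': "a = ennreal a'" "a' \<ge> 0" using b(1) by (cases a) auto
  have ac: "a' < c" using b(1) c a' by (simp add: ennreal_less_iff)
  have bb: "bayes_bound p eta n (real n * c)"
    using b(2) c by (intro bayes_bound_if_less_minimax_risk p n) auto
  have low: "ennreal (real (N div n) * (real n * c) / real N) \<le> minimax_risk N p eta" for N
  proof -
    have "bayes_bound p eta (N div n * n + N mod n) (real (N div n) * (real n * c) + 0)"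
      by (intro bayes_bound_add bayes_bound_mult bb bayes_bound_0) (use c in auto)
    then show ?thesis by (intro minimax_risk_ge) simp
  qed
  \<comment> \<open>At most \<open>n\<close> of the \<open>N\<close> coordinates are wasted. The
    strict gap \<open>a' < c\<close> absorbs this loss for large \<open>N\<close>.\<close>
  have "((\<lambda>N. (1 - real n / real N) * c) \<longlongrightarrow> (1 - 0) * c) sequentially"
    by (intro tendsto_intros lim_const_over_n)
  then have "eventually (\<lambda>N. (1 - real n / real N) * c > a') sequentially"
    using ac by (intro order_tendstoD) auto
  with eventually_gt_at_top[of 0] show "eventually (\<lambda>N. a < minimax_risk N p eta) sequentially"
  proof eventually_elim
    case (elim N)
    have "N = N div n * n + N mod n" by simp
    moreover have "N mod n \<le> n" using n(1) by (simp add: less_imp_le)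
    ultimately have "real N \<le> real (N div n) * real n + real n"
      by (metis add_left_mono of_nat_add of_nat_le_iff of_nat_mult)
    then have "(real N - real n) / real N \<le> real (N div n) * real n / real N"
      by (intro divide_right_mono) auto
    then have "1 - real n / real N \<le> real (N div n) * real n / real N"
      using elim by (simp add: diff_divide_distrib)
    then have "(1 - real n / real N) * c \<le> real (N div n) * (real n * c) / real N"
      using c mult_right_mono[of _ _ c] by (fastforce simp: mult.assoc)
    with elim have "a < ennreal (real (N div n) * (real n * c) / real N)"
      unfolding a' using a' by (intro ennreal_lessI) auto
    also note low
    finally show ?case .
  qed
qed

subsection \<open>The threshold estimator\<close>

text \<open>An integrable majorant. Near 0, the bound \<open>ln x \<le> x\<close> at
  \<open>x = z powr (-1/4)\<close> leaves the integrable power \<open>-1/2\<close>; for large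
  \<open>z\<close>, \<open>ln z \<le> 2 * sqrt z\<close> together with half of the exponential
  leaves a multiple of an exponential density, whose integral is 1.\<close>

lemma ln_sq_le:
  fixes z :: real assumes "z > 0"
  shows "(ln z)\<^sup>2 * exp (- z / 2) \<le> 16 * (z powr (-1/2) * indicator {0..1} z) + 64 * exponential_density (1/4) z"
proof (cases "z \<le> 1")
  case True
  define x where "x = z powr (-1/4)"
  have x: "ln x = - ln z / 4" "x > 0" using assms by (auto simp: x_def ln_powr)
  have "- ln z / 4 \<le> x" using ln_le_minus_one[OF x(2)] x by linarith
  then have "(- ln z)\<^sup>2 \<le> (4 * x)\<^sup>2" using assms True by (intro power_mono) auto
  also have "\<dots> = 16 * z powr (-1/2)"
    unfolding x_def power_mult_distrib by (simp add: power2_eq_square powr_add[symmetric])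
  finally have "(ln z)\<^sup>2 * exp (- z / 2) \<le> 16 * z powr (-1/2) * 1"
    using assms by (intro mult_mono) auto
  then show ?thesis
    using True assms by (intro add_increasing2) (auto simp: exponential_density_nonneg)
next
  case False
  have z4: "z / 4 \<le> exp (z / 4)" using exp_ge_add_one_self[of "z / 4"] by linarith
  have "ln z = 2 * ln (sqrt z)" using assms by (simp add: ln_sqrt)
  also have "\<dots> \<le> 2 * sqrt z" using ln_le_minus_one[of "sqrt z"] assms by auto
  finally have "(ln z)\<^sup>2 \<le> (2 * sqrt z)\<^sup>2" using False by (intro power_mono) auto
  also have "\<dots> = 4 * z" using assms by (simp add: power_mult_distrib)
  finally have "(ln z)\<^sup>2 * exp (- z / 2) \<le> 4 * z * exp (- z / 2)" by (intro mult_right_mono) auto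
  also have "4 * z * exp (- z / 2) = 16 * (z / 4) * (exp (- z / 4) * exp (- z / 4))" by (simp add: exp_add[symmetric])
  also have "\<dots> \<le> 16 * exp (z / 4) * (exp (- z / 4) * exp (- z / 4))"
    by (intro mult_right_mono mult_left_mono z4) auto
  also have "\<dots> = 16 * exp (- z / 4)" by (simp add: exp_minus)
  also have "\<dots> = 64 * exponential_density (1/4) z" using assms by (simp add: exponential_density_def)
  finally show ?thesis using False by simp
qed

text \<open>The weight is \<open>exp (- z / 2)\<close> instead of the density
  \<open>exp (- z)\<close>: the other half of the exponent is kept in reserve for tail bounds. Only
  finiteness of the constant matters.\<close>

definition log_moment :: real where
  "log_moment = enn2real (\<integral>\<^sup>+z. ennreal ((ln z)\<^sup>2 * exp (- z / 2)) * indicator {0<..} z \<partial>lborel)"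

lemma log_moment:
  "(\<integral>\<^sup>+z. ennreal ((ln z)\<^sup>2 * exp (- z / 2)) * indicator {0<..} z \<partial>lborel) = ennreal log_moment"
proof -
  have "(\<integral>\<^sup>+z. ennreal ((ln z)\<^sup>2 * exp (- z / 2)) * indicator {0<..} z \<partial>lborel)
     \<le> (\<integral>\<^sup>+z. ennreal 16 * (ennreal (z powr (-1/2)) * indicator {0..1} z) + ennreal 64 * ennreal (exponential_density (1/4) z) \<partial>lborel)"
  proof (intro nn_integral_mono)
    fix z :: real
    have "ennreal ((ln z)\<^sup>2 * exp (- z / 2)) \<le> ennreal (16 * (z powr (-1/2) * indicator {0..1} z) + 64 * exponential_density (1/4) z)" if "z > 0"
      using ln_sq_le[OF that] by (rule ennreal_leI)
    also have "ennreal (16 * (z powr (-1/2) * indicator {0..1} z) + 64 * exponential_density (1/4) z)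
       = ennreal 16 * (ennreal (z powr (-1/2)) * indicator {0..1} z) + ennreal 64 * ennreal (exponential_density (1/4) z)"
      by (subst ennreal_plus) (auto simp: exponential_density_nonneg ennreal_mult' ennreal_indicator)
    finally show "ennreal ((ln z)\<^sup>2 * exp (- z / 2)) * indicator {0<..} z
      \<le> ennreal 16 * (ennreal (z powr (-1/2)) * indicator {0..1} z) + ennreal 64 * ennreal (exponential_density (1/4) z)"
      by (auto simp: indicator_def)
  qed
  also have "\<dots> = ennreal 16 * (\<integral>\<^sup>+z. ennreal (z powr (-1/2)) * indicator {0..1} z \<partial>lborel) + ennreal 64 * (\<integral>\<^sup>+z. ennreal (exponential_density (1/4) z) \<partial>lborel)"
    by (subst nn_integral_add) (auto simp: nn_integral_cmult)
  also have "(\<integral>\<^sup>+z. ennreal (z powr (-1/2)) * indicator {0..1} z \<partial>lborel) = ennreal (1 powr (-1/2+1) / (-1/2+1))"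
    by (intro nn_integral_has_integral_lebesgue' has_integral_powr_from_0) auto
  also have "(\<integral>\<^sup>+z. ennreal (exponential_density (1/4) z) \<partial>lborel) = 1"
  proof -
    interpret prob_space "exp_law 4" by (rule prob_space_exp_law) simp
    have "(\<integral>\<^sup>+z. 1 \<partial>exp_law 4) = 1" by (simp add: emeasure_space_1[simplified])
    then show ?thesis by (subst (asm) nn_integral_exp_law) auto
  qed
  also have "ennreal 16 * ennreal (1 powr (-1/2+1) / (-1/2+1)) + ennreal 64 * 1 < \<top>"
    by (simp add: ennreal_mult_less_top)
  finally show ?thesis unfolding log_moment_def by (metis ennreal_enn2real)
qed

lemma log_moment_nonneg: "log_moment \<ge> 0"
  by (simp add: log_moment_def)

lemma exp_law_1_atMost_le:
  assumes "s \<ge> 0"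
  shows "(\<integral>\<^sup>+z. indicator {..s} z \<partial>exp_law 1) \<le> ennreal (min 1 s)"
proof -
  interpret prob_space "exp_law 1" by (rule prob_space_exp_law) simp
  have "(\<integral>\<^sup>+z. indicator {..s} z \<partial>exp_law 1) \<le> (\<integral>\<^sup>+z. 1 \<partial>exp_law 1)"
    by (intro nn_integral_mono) (auto simp: indicator_def)
  also have "\<dots> = 1" by (simp add: emeasure_space_1[simplified])
  finally have 1: "(\<integral>\<^sup>+z. indicator {..s} z \<partial>exp_law 1) \<le> ennreal 1" by simp
  have "(\<integral>\<^sup>+z. indicator {..s} z \<partial>exp_law 1) = (\<integral>\<^sup>+z. ennreal (exponential_density 1 z) * indicator {..s} z \<partial>lborel)"
    by (subst nn_integral_exp_law) auto
  also have "\<dots> \<le> (\<integral>\<^sup>+z. indicator {0..s} z \<partial>lborel)"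
    by (intro nn_integral_mono) (auto simp: indicator_def exponential_density_def)
  also have "\<dots> = ennreal s" using assms by simp
  finally show ?thesis using 1 by (simp add: min_def)
qed

text \<open>On \<open>z > s\<close> one half of the exponent yields \<open>exp (- s / 2)\<close>,
  and the other half keeps \<open>(ln z)\<^sup>2\<close> integrable.\<close>

lemma log_moment_tail_le:
  assumes "s \<ge> 0"
  shows "(\<integral>\<^sup>+z. ennreal ((ln z)\<^sup>2) * indicator {s<..} z \<partial>exp_law 1) \<le> ennreal (log_moment * exp (- s / 2))"
proof -
  have "(\<integral>\<^sup>+z. ennreal ((ln z)\<^sup>2) * indicator {s<..} z \<partial>exp_law 1)
      = (\<integral>\<^sup>+z. ennreal (exponential_density 1 z) * (ennreal ((ln z)\<^sup>2) * indicator {s<..} z) \<partial>lborel)"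
    by (subst nn_integral_exp_law) auto
  also have "\<dots> \<le> (\<integral>\<^sup>+z. ennreal (exp (- s / 2)) * (ennreal ((ln z)\<^sup>2 * exp (- z / 2)) * indicator {0<..} z) \<partial>lborel)"
  proof (intro nn_integral_mono)
    fix z :: real
    have "exp (-z) * (ln z)\<^sup>2 \<le> exp (- s / 2) * ((ln z)\<^sup>2 * exp (- z / 2))" if "s < z"
    proof -
      have "exp (-z) \<le> exp (- s / 2) * exp (- z / 2)" using that by (simp add: exp_add[symmetric])
      from mult_right_mono[OF this, of "(ln z)\<^sup>2"] show ?thesis by (simp add: mult_ac)
    qed
    then show "ennreal (exponential_density 1 z) * (ennreal ((ln z)\<^sup>2) * indicator {s<..} z)
      \<le> ennreal (exp (- s / 2)) * (ennreal ((ln z)\<^sup>2 * exp (- z / 2)) * indicator {0<..} z)"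
      using assms by (auto simp: indicator_def exponential_density_def ennreal_mult'[symmetric] intro!: ennreal_leI)
  qed
  also have "\<dots> = ennreal (exp (- s / 2)) * ennreal log_moment"
    by (subst nn_integral_cmult, simp, subst log_moment, rule refl)
  also have "\<dots> = ennreal (log_moment * exp (- s / 2))" by (simp add: ennreal_mult'[symmetric] mult.commute log_moment_nonneg)
  finally show ?thesis .
qed

text \<open>The loss from missing a large mean; this produces the sharp constant. Up to
  \<open>\<theta> = ln t\<close> the minimum is bounded by 1 and \<open>\<theta>^(2-p)\<close> is
  increasing. Beyond, with \<open>u = \<theta> - ln t\<close>, the growth
  \<open>(1 + u / ln t)^(2-p)\<close> is at most \<open>(1 + u / 2)^2 \<le> exp u\<close>, so the
  exponential wins. The condition \<open>t \<ge> exp 2\<close> is exactly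
  \<open>ln t \<ge> 2\<close>.\<close>

lemma sq_mult_min_le:
  fixes p t \<theta> :: real
  assumes p: "0 < p" "p < 2" and t: "t \<ge> exp 2" and \<theta>: "\<theta> \<ge> 0"
  shows "\<theta>\<^sup>2 * min 1 (t * exp (-\<theta>)) \<le> (ln t) powr (2 - p) * \<theta> powr p"
proof (cases "\<theta> = 0")
  case False
  then have pos: "\<theta> > 0" using \<theta> by simp
  have t0: "t > 0" using t less_le_trans[OF exp_gt_zero] by blast
  have L: "ln t \<ge> 2" using t t0 by (simp add: ln_ge_iff)
  have sq: "\<theta>\<^sup>2 = \<theta> powr (2 - p) * \<theta> powr p"
    using pos by (simp add: powr_add[symmetric])
  have "\<theta> powr (2 - p) * min 1 (t * exp (-\<theta>)) \<le> (ln t) powr (2 - p)"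
  proof (cases "\<theta> \<le> ln t")
    case True
    have "\<theta> powr (2 - p) * min 1 (t * exp (-\<theta>)) \<le> \<theta> powr (2 - p) * 1" by (intro mult_left_mono) auto
    also have "\<dots> \<le> (ln t) powr (2 - p)" using True p pos by (simp add: powr_mono2)
    finally show ?thesis .
  next
    case False
    define u where "u = \<theta> - ln t"
    have u: "u > 0" using False by (simp add: u_def)
    have "(\<theta> / ln t) powr (2 - p) \<le> (\<theta> / ln t) powr 2"
      using False L p by (intro powr_mono) auto
    also have "\<dots> = (\<theta> / ln t)\<^sup>2" using pos L by simp
    also have "(\<theta> / ln t)\<^sup>2 = (1 + u / ln t)\<^sup>2" using L by (simp add: u_def field_simps)
    also have "(1 + u / ln t)\<^sup>2 \<le> (1 + u / 2)\<^sup>2" using L u by (intro power_mono add_left_mono divide_left_mono) auto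
    also have "\<dots> \<le> (exp (u / 2))\<^sup>2" using u exp_ge_add_one_self[of "u / 2"] by (intro power_mono) auto
    also have "\<dots> = exp u" by (simp add: power2_eq_square exp_add[symmetric])
    finally have le: "\<theta> powr (2 - p) \<le> (ln t) powr (2 - p) * exp u"
      using pos L by (simp add: powr_divide field_simps)
    have "\<theta> powr (2 - p) * min 1 (t * exp (-\<theta>)) \<le> \<theta> powr (2 - p) * (t * exp (-\<theta>))"
      by (intro mult_left_mono) auto
    also have "\<dots> \<le> (ln t) powr (2 - p) * exp u * (t * exp (-\<theta>))"
      using t0 le by (intro mult_right_mono) auto
    also have "\<dots> = (ln t) powr (2 - p)"
      using t0 by (simp add: u_def exp_diff exp_minus)
    finally show ?thesis .
  qed
  from mult_right_mono[OF this, of "\<theta> powr p"] show ?thesis by (simp add: sq mult_ac)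
qed simp

text \<open>For \<open>\<theta> \<ge> 1\<close> the budget term \<open>\<theta> powr p\<close> alone
  suffices. For \<open>1 / t \<le> \<theta> < 1\<close> the relative threshold is still at least
  \<open>t / 3\<close>, and \<open>(t * \<theta>) powr p \<ge> 1\<close> buys the factor. For
  \<open>\<theta> < 1 / t\<close> it is at least \<open>t - 1\<close>; this near-null case alone
  needs a term independent of \<open>\<theta>\<close>, which has to be exponentially small.\<close>

lemma exp_tail_le:
  fixes p t \<theta> :: real
  assumes p: "0 < p" and t: "t \<ge> 1" and \<theta>: "\<theta> \<ge> 0"
  shows "exp (- (t * exp (-\<theta>)) / 2) \<le> (1 + t powr p * exp (- t / 6)) * \<theta> powr p + exp (- (t - 1) / 2)"
proof -
  consider "\<theta> \<ge> 1" | "\<theta> < 1" "\<theta> * t \<ge> 1" | "\<theta> * t < 1" by linarith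
  then show ?thesis
  proof cases
    case 1
    have "exp (- (t * exp (-\<theta>)) / 2) \<le> 1" using t by simp
    also have "\<dots> \<le> \<theta> powr p" using 1 p by (simp add: ge_one_powr_ge_zero)
    also have "\<dots> \<le> (1 + t powr p * exp (- t / 6)) * \<theta> powr p + exp (- (t - 1) / 2)"
      by (simp add: distrib_right)
    finally show ?thesis .
  next
    case 2
    have "1 / 3 \<le> exp (-1::real)" using exp_le by (simp add: exp_minus field_simps)
    also have "\<dots> \<le> exp (-\<theta>)" using 2 by simp
    finally have "t / 3 \<le> t * exp (-\<theta>)" using t mult_left_mono[of "1/3" "exp (-\<theta>)" t] by simp
    then have "exp (- (t * exp (-\<theta>)) / 2) \<le> exp (- t / 6)" by simp
    also have "\<dots> \<le> exp (- t / 6) * (t * \<theta>) powr p"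
      using 2 p by (simp add: ge_one_powr_ge_zero mult.commute)
    also have "\<dots> = t powr p * exp (- t / 6) * \<theta> powr p" using t \<theta> by (simp add: powr_mult)
    also have "\<dots> \<le> (1 + t powr p * exp (- t / 6)) * \<theta> powr p + exp (- (t - 1) / 2)"
      by (simp add: distrib_right)
    finally show ?thesis .
  next
    case 3
    have "1 - \<theta> \<le> exp (-\<theta>)" using exp_ge_add_one_self[of "-\<theta>"] by simp
    then have "t * (1 - \<theta>) \<le> t * exp (-\<theta>)" using t by (intro mult_left_mono) auto
    then have "t - 1 \<le> t * exp (-\<theta>)" using 3 by (simp add: algebra_simps)
    then have "exp (- (t * exp (-\<theta>)) / 2) \<le> exp (- (t - 1) / 2)" by simp
    also have "\<dots> \<le> (1 + t powr p * exp (- t / 6)) * \<theta> powr p + exp (- (t - 1) / 2)"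
      by simp
    finally show ?thesis .
  qed
qed

section \<open>Risk of the threshold rule\<close>

definition threshold_ln :: "real \<Rightarrow> real \<Rightarrow> real" where
  "threshold_ln t x = (if x > t then ln x else 0)"

lemma measurable_threshold_ln [measurable]: "threshold_ln t \<in> borel_measurable borel"
  unfolding threshold_ln_def by measurable

text \<open>The price per unit of budget. The second summand stays bounded as \<open>t\<close>
  grows, so \<open>ln t powr (2 - p)\<close> dominates.\<close>

definition threshold_slope :: "real \<Rightarrow> real \<Rightarrow> real" where
  "threshold_slope p t = ln t powr (2 - p) + log_moment * (1 + t powr p * exp (- t / 6))"

text \<open>Writing the observation as \<open>exp \<theta> * z\<close> with \<open>z\<close>
  standard exponential, the loss is \<open>\<theta>\<^sup>2\<close> for \<open>z \<le> s\<close> and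
  \<open>(ln z)\<^sup>2\<close> for \<open>z > s\<close>. The two parts are bounded by
  \<open>sq_mult_min_le\<close> and \<open>exp_tail_le\<close>.\<close>

lemma threshold_ln_risk_le:
  assumes p: "0 < p" "p < 2" and t: "t \<ge> exp 2" and \<theta>: "\<theta> \<ge> 0"
  shows "(\<integral>\<^sup>+x. ennreal ((threshold_ln t x - \<theta>)\<^sup>2) \<partial>exp_law (exp \<theta>))
     \<le> ennreal (threshold_slope p t * \<theta> powr p + log_moment * exp (- (t - 1) / 2))"
proof -
  define s where "s = t * exp (-\<theta>)"
  have t1: "t \<ge> 1" using t by (meson dual_order.trans exp_ge_add_one_self le_add_same_cancel1 one_le_exp_iff zero_le_numeral)
  have s: "s > 0" using t1 by (simp add: s_def)
  have eq: "exp \<theta> * z > t \<longleftrightarrow> z > s" for z by (simp add: s_def exp_minus field_simps)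
  have "(\<integral>\<^sup>+x. ennreal ((threshold_ln t x - \<theta>)\<^sup>2) \<partial>exp_law (exp \<theta>))
      = (\<integral>\<^sup>+z. ennreal ((threshold_ln t (exp \<theta> * z) - \<theta>)\<^sup>2) \<partial>exp_law 1)"
    using nn_integral_exp_law_scale[of "\<lambda>x. ennreal ((threshold_ln t x - \<theta>)\<^sup>2)" "exp \<theta>" 1] by simp
  also have "\<dots> = (\<integral>\<^sup>+z. ennreal (\<theta>\<^sup>2) * indicator {..s} z + ennreal ((ln z)\<^sup>2) * indicator {s<..} z \<partial>exp_law 1)"
    using s by (intro nn_integral_cong) (auto simp: threshold_ln_def eq indicator_def ln_mult)
  also have "\<dots> = ennreal (\<theta>\<^sup>2) * (\<integral>\<^sup>+z. indicator {..s} z \<partial>exp_law 1) + (\<integral>\<^sup>+z. ennreal ((ln z)\<^sup>2) * indicator {s<..} z \<partial>exp_law 1)"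
    by (subst nn_integral_add) (auto simp: nn_integral_cmult)
  also have "\<dots> \<le> ennreal (\<theta>\<^sup>2) * ennreal (min 1 s) + ennreal (log_moment * exp (- s / 2))"
    using s by (intro add_mono mult_left_mono exp_law_1_atMost_le log_moment_tail_le) auto
  also have "\<dots> = ennreal (\<theta>\<^sup>2 * min 1 s + log_moment * exp (- s / 2))"
    using s log_moment_nonneg by (simp add: ennreal_mult'[symmetric] ennreal_plus[symmetric] del: ennreal_plus)
  also have "\<dots> \<le> ennreal (threshold_slope p t * \<theta> powr p + log_moment * exp (- (t - 1) / 2))"
  proof (rule ennreal_leI)
    have "\<theta>\<^sup>2 * min 1 s \<le> ln t powr (2 - p) * \<theta> powr p" unfolding s_def by (rule sq_mult_min_le[OF p t \<theta>])
    moreover have "log_moment * exp (- s / 2)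
      \<le> log_moment * ((1 + t powr p * exp (- t / 6)) * \<theta> powr p + exp (- (t - 1) / 2))"
      unfolding s_def by (intro mult_left_mono exp_tail_le p t1 \<theta> log_moment_nonneg)
    ultimately show "\<theta>\<^sup>2 * min 1 s + log_moment * exp (- s / 2)
        \<le> threshold_slope p t * \<theta> powr p + log_moment * exp (- (t - 1) / 2)"
      unfolding threshold_slope_def by (simp add: algebra_simps)
  qed
  finally show ?thesis .
qed

text \<open>The coordinate bound is affine in \<open>ln (mu i) powr p\<close>, so summing it uses
  the constraint exactly once, and the result does not depend on \<open>n\<close>.\<close>

lemma minimax_risk_threshold_le:
  assumes p: "0 < p" "p < 2" and t: "t \<ge> exp 2" and n: "n > 0"
  shows "minimax_risk n p eta \<le> ennreal (threshold_slope p t * eta powr p + log_moment * exp (- (t - 1) / 2))"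
proof -
  define \<alpha> where "\<alpha> = threshold_slope p t"
  define \<beta> where "\<beta> = log_moment * exp (- (t - 1) / 2)"
  have \<alpha>\<beta>: "\<alpha> \<ge> 0" "\<beta> \<ge> 0"
    using log_moment_nonneg by (auto simp: \<alpha>_def \<beta>_def threshold_slope_def intro!: add_nonneg_nonneg)
  have "minimax_risk n p eta \<le> ennreal (real n * (\<alpha> * eta powr p + \<beta>) / real n)"
  proof (rule minimax_risk_le)
    show d: "(\<lambda>x i. threshold_ln t (x i)) \<in> log_estimators n"
      unfolding log_estimators_def by auto
    fix mu assume mu: "mu \<in> param_space n p eta"
    then have m1: "mu i \<ge> 1" if "i < n" for i using that by (auto simp: param_space_iff)
    then have m0: "mu i > 0" if "i < n" for i using that by force
    have meas: "(\<lambda>x. ennreal ((threshold_ln t (x i) - ln (mu i))\<^sup>2)) \<in> borel_measurable (data_law n mu)" if "i < n" for i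
    proof -
      have "(\<lambda>x. x i) \<in> borel_measurable (PiM {..<n} (\<lambda>_. lborel))" using that by auto
      then have [measurable]: "(\<lambda>x. x i) \<in> borel_measurable (data_law n mu)" by (simp cong: measurable_cong_sets)
      show ?thesis by measurable
    qed
    have "total_risk n (\<lambda>x i. threshold_ln t (x i)) mu = (\<integral>\<^sup>+x. (\<Sum>i<n. ennreal ((threshold_ln t (x i) - ln (mu i))\<^sup>2)) \<partial>data_law n mu)"
      unfolding total_risk_def by simp
    also have "\<dots> = (\<Sum>i<n. \<integral>\<^sup>+x. ennreal ((threshold_ln t (x i) - ln (mu i))\<^sup>2) \<partial>data_law n mu)"
      using meas by (intro nn_integral_sum) auto
    also have "\<dots> = (\<Sum>i<n. \<integral>\<^sup>+x. ennreal ((threshold_ln t x - ln (mu i))\<^sup>2) \<partial>exp_law (mu i))"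
      by (intro sum.cong refl nn_integral_data_law_component) (auto simp: m0)
    also have "\<dots> \<le> (\<Sum>i<n. ennreal (\<alpha> * ln (mu i) powr p + \<beta>))"
    proof (intro sum_mono)
      fix i assume "i \<in> {..<n}"
      then show "(\<integral>\<^sup>+x. ennreal ((threshold_ln t x - ln (mu i))\<^sup>2) \<partial>exp_law (mu i)) \<le> ennreal (\<alpha> * ln (mu i) powr p + \<beta>)"
        using threshold_ln_risk_le[OF p t, of "ln (mu i)"] m0[of i] m1[of i] unfolding \<alpha>_def \<beta>_def by simp
    qed
    also have "\<dots> = ennreal (\<alpha> * (\<Sum>i<n. ln (mu i) powr p) + real n * \<beta>)"
      using \<alpha>\<beta> by (subst sum_ennreal) (auto simp: sum.distrib sum_distrib_left)
    also have "\<dots> \<le> ennreal (real n * (\<alpha> * eta powr p + \<beta>))"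
      using mu \<alpha>\<beta> mult_left_mono[of "\<Sum>i<n. ln (mu i) powr p" "real n * eta powr p" \<alpha>]
      by (intro ennreal_leI) (auto simp: param_space_iff algebra_simps)
    finally show "total_risk n (\<lambda>x i. threshold_ln t (x i)) mu \<le> ennreal (real n * (\<alpha> * eta powr p + \<beta>))" .
  qed
  then show ?thesis using n unfolding \<alpha>_def \<beta>_def by simp
qed

subsection \<open>The single spike prior\<close>

definition spike :: "real \<Rightarrow> nat \<Rightarrow> nat \<Rightarrow> real" where
  "spike m j = (\<lambda>i. if i = j then exp m else 1)"

lemma spike_pos: "spike m j i > 0"
  by (simp add: spike_def)

lemma spike_param_space:
  assumes "m \<ge> 0" "j < n" "m powr p \<le> real n * eta powr p"
  shows "spike m j \<in> param_space n p eta"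
proof -
  have "ln (spike m j i) powr p = (if i = j then m powr p else 0)" for i
    by (simp add: spike_def)
  then show ?thesis using assms by (auto simp: param_space_iff sum.delta spike_def)
qed

text \<open>Moving the spike from \<open>j\<close> to \<open>i\<close> costs a factor \<open>exp m\<close> at \<open>i\<close> and, after truncation at \<open>s\<close>,
  a factor \<open>exp s / exp m\<close> at \<open>j\<close>.\<close>

lemma spike_dominated:
  assumes f: "f \<in> borel_measurable (PiM {..<n} (\<lambda>_. lborel))" and ij: "i \<noteq> j" "i < n" "j < n" and m: "m \<ge> 0"
  shows "(\<integral>\<^sup>+x. f x * indicator {..s} (x j) \<partial>data_law n (spike m j)) \<le> ennreal (exp s) * (\<integral>\<^sup>+x. f x \<partial>data_law n (spike m i))"
proof -
  define q :: "nat \<Rightarrow> real \<Rightarrow> ennreal" where "q k x = (if k = j then indicator {..s} x else 1)" for k x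
  define c where "c k = (if k = j then ennreal (exp s / exp m) else 1) * (if k = i then ennreal (exp m) else 1)" for k
  have f': "f \<in> borel_measurable (PiM {..<n} (\<lambda>k. exp_law (spike m i k)))"
    using f unfolding data_law_eq[symmetric] by (simp cong: measurable_cong_sets)
  have "(\<integral>\<^sup>+x. f (\<lambda>k\<in>{..<n}. x k) * (\<Prod>k<n. q k (x k)) \<partial>PiM {..<n} (\<lambda>k. exp_law (spike m j k)))
      \<le> (\<Prod>k<n. c k) * (\<integral>\<^sup>+x. f x \<partial>PiM {..<n} (\<lambda>k. exp_law (spike m i k)))"
  proof (rule nn_integral_PiM_dominated[OF product_sigma_finite_exp_law product_sigma_finite_exp_law _ _ _ _ f'])
    fix k and h :: "real \<Rightarrow> ennreal" assume "k \<in> {..<n}" "h \<in> borel_measurable (exp_law (spike m i k))"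
    then have h[measurable]: "h \<in> borel_measurable borel" by (simp cong: measurable_cong_sets)
    consider "k = j" | "k = i" | "k \<noteq> j" "k \<noteq> i" by blast
    then show "(\<integral>\<^sup>+x. h x * q k x \<partial>exp_law (spike m j k)) \<le> c k * (\<integral>\<^sup>+x. h x \<partial>exp_law (spike m i k))"
    proof cases
      case 1
      then show ?thesis using ij nn_integral_exp_law_truncated_le[OF h, of "exp m" s]
        by (simp add: q_def c_def spike_def)
    next
      case 2
      then show ?thesis using ij m nn_integral_exp_law_le_larger_mean[OF h, of 1 "exp m"]
        by (simp add: q_def c_def spike_def)
    next
      case 3
      then show ?thesis by (simp add: q_def c_def spike_def)
    qed
  next
    show "q k \<in> borel_measurable (exp_law (spike m j k))" for k
      unfolding q_def by (cases "k = j") auto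
  qed auto
  \<comment> \<open>The factor \<open>exp m\<close> at \<open>i\<close> cancels the
    \<open>1 / exp m\<close> at \<open>j\<close>; only the truncation level remains.\<close>
  moreover have "(\<Prod>k<n. c k) = ennreal (exp s)"
    unfolding c_def prod.distrib using ij by (simp add: prod.delta ennreal_mult'[symmetric])
  moreover have "(\<integral>\<^sup>+x. f (\<lambda>k\<in>{..<n}. x k) * (\<Prod>k<n. q k (x k)) \<partial>PiM {..<n} (\<lambda>k. exp_law (spike m j k)))
      = (\<integral>\<^sup>+x. f x * indicator {..s} (x j) \<partial>data_law n (spike m j))"
    unfolding data_law_eq
  proof (intro nn_integral_cong)
    fix x assume "x \<in> space (PiM {..<n} (\<lambda>k. exp_law (spike m j k)))"
    then have "(\<lambda>k\<in>{..<n}. x k) = x" by (auto simp: space_PiM PiE_def extensional_restrict)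
    moreover have "(\<Prod>k<n. q k (x k)) = indicator {..s} (x j)" unfolding q_def using ij by (simp add: prod.delta)
    ultimately show "f (\<lambda>k\<in>{..<n}. x k) * (\<Prod>k<n. q k (x k)) = f x * indicator {..s} (x j)" by simp
  qed
  ultimately show ?thesis unfolding data_law_eq by simp
qed

lemma exp_law_atMost_eq:
  assumes "K \<ge> 0"
  shows "(\<integral>\<^sup>+x. indicator {..K * exp m} x \<partial>exp_law (exp m)) = ennreal (1 - exp (-K))"
proof -
  have "(\<integral>\<^sup>+x. indicator {..K * exp m} x \<partial>exp_law (exp m)) = (\<integral>\<^sup>+x. indicator {..K * exp m} (exp m * x) \<partial>exp_law 1)"
    using nn_integral_exp_law_scale[of "indicator {..K * exp m}" "exp m" 1] by simp
  also have "\<dots> = (\<integral>\<^sup>+x. ennreal (exponential_density 1 x) * indicator {..K * exp m} (exp m * x) \<partial>lborel)"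
    by (subst nn_integral_exp_law) auto
  also have "\<dots> = (\<integral>\<^sup>+x. ennreal (x ^ 0 * exp (-x)) * indicator {0..K} x \<partial>lborel)"
    by (intro nn_integral_cong) (auto simp: indicator_def exponential_density_def)
  also have "\<dots> = ennreal (1 - exp (-K))"
    using assms by (subst nn_intergal_power_times_exp_Icc) auto
  finally show ?thesis .
qed

text \<open>Completing the square around the minimiser \<open>d = m / (1 + A)\<close>, the posterior
  mean when \<open>m\<close> and 0 have odds 1 to \<open>A\<close>.\<close>

lemma weighted_two_point_sq_ge:
  fixes A d m :: real
  assumes "A \<ge> 0"
  shows "m\<^sup>2 * (1 - 1 / (1 + A)) \<le> (d - m)\<^sup>2 + A * d\<^sup>2"
proof -
  define k where "k = 1 / (1 + A)"
  have k: "k * (1 + A) = 1" using assms by (simp add: k_def)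
  have "(d - m)\<^sup>2 + A * d\<^sup>2 - m\<^sup>2 * (1 - k) = (1 + A) * (d - m * k)\<^sup>2"
    using k by algebra
  also have "\<dots> \<ge> 0" using assms by simp
  finally show ?thesis by (simp add: k_def)
qed

text \<open>No posterior is computed. For a fixed coordinate \<open>j\<close>, the
  \<open>n - 1\<close> laws with the spike elsewhere each dominate \<open>exp (-s)\<close> times the
  truncated law with the spike at \<open>j\<close>. Hence all errors at \<open>j\<close> are
  compared under one law, as a two-point problem with odds \<open>A\<close>. The truncation retains
  probability \<open>1 - exp (-K)\<close>.\<close>

lemma bayes_bound_spike:
  assumes n: "n > 0" and m: "m \<ge> 0" and K: "K \<ge> 0" and mn: "m powr p \<le> real n * eta powr p"
  defines "A \<equiv> (real n - 1) * exp (- (K * exp m))"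
  shows "bayes_bound p eta n (m\<^sup>2 * (1 - 1 / (1 + A)) * (1 - exp (-K)))"
proof -
  define b where "b = m\<^sup>2 * (1 - 1 / (1 + A))"
  define s where "s = K * exp m"
  have A: "A \<ge> 0" using n by (simp add: A_def)
  have b: "b \<ge> 0" using A by (simp add: b_def)
  define W where "W = map_pmf (spike m) (pmf_of_set {..<n})"
  have ne: "{..<n} \<noteq> {}" using n by auto
  have W: "finite (set_pmf W)" "set_pmf W \<subseteq> param_space n p eta"
    using ne m mn by (auto simp: W_def intro!: spike_param_space)
  have "ennreal (b * (1 - exp (-K))) \<le> (\<integral>\<^sup>+g. total_risk n d g \<partial>measure_pmf W)" if d: "d \<in> log_estimators n" for d
  proof -
    define R where "R i j = (\<integral>\<^sup>+x. ennreal ((d x j - (if i = j then m else 0))\<^sup>2) \<partial>data_law n (spike m i))" for i j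
    have dm: "(\<lambda>x. d x j) \<in> borel_measurable (PiM {..<n} (\<lambda>_. lborel))" if "j < n" for j
      using d that by (auto simp: log_estimators_def)
    then have dm'[measurable]: "(\<lambda>x. d x j) \<in> borel_measurable (data_law n g)" if "j < n" for j g
      using that by (simp cong: measurable_cong_sets)
    have tot: "total_risk n d (spike m i) = (\<Sum>j<n. R i j)" for i
    proof -
      have "total_risk n d (spike m i) = (\<integral>\<^sup>+x. (\<Sum>j<n. ennreal ((d x j - (if i = j then m else 0))\<^sup>2)) \<partial>data_law n (spike m i))"
        unfolding total_risk_def by (intro nn_integral_cong) (auto simp: spike_def intro!: sum.cong arg_cong[where f = ennreal])
      also have "\<dots> = (\<Sum>j<n. R i j)"
        unfolding R_def using dm' by (intro nn_integral_sum) auto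
      finally show ?thesis .
    qed
    \<comment> \<open>The error at coordinate \<open>j\<close> is summed over all spike positions
      \<open>i\<close>; swapping the two sums below and dividing by \<open>n\<close> turns these
      column bounds into a bound on the Bayes risk.\<close>
    have col: "ennreal (b * (1 - exp (-K))) \<le> (\<Sum>i<n. R i j)" if j: "j < n" for j
    proof -
      define F where "F = (\<integral>\<^sup>+x. ennreal ((d x j)\<^sup>2) * indicator {..s} (x j) \<partial>data_law n (spike m j))"
      have xj[measurable]: "(\<lambda>x. x j) \<in> borel_measurable (data_law n (spike m j))"
      proof -
        have "(\<lambda>x. x j) \<in> borel_measurable (PiM {..<n} (\<lambda>_. lborel))" using j by auto
        then show ?thesis by (simp cong: measurable_cong_sets)
      qed
      note [measurable] = dm'[OF j]
      have off: "ennreal (exp (-s)) * F \<le> R i j" if i: "i < n" "i \<noteq> j" for i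
      proof -
        have "F \<le> ennreal (exp s) * R i j"
          unfolding F_def R_def using spike_dominated[OF _ i(2,1) j m, of "\<lambda>x. ennreal ((d x j)\<^sup>2)" s] dm[OF j] i by simp
        then have "ennreal (exp (-s)) * F \<le> ennreal (exp (-s)) * (ennreal (exp s) * R i j)"
          by (rule mult_left_mono) simp
        also have "\<dots> = R i j" by (simp add: mult.assoc[symmetric] ennreal_mult'[symmetric] exp_minus)
        finally show ?thesis .
      qed
      have "ennreal (b * (1 - exp (-K))) = ennreal b * (\<integral>\<^sup>+x. indicator {..s} x \<partial>exp_law (spike m j j))"
        using exp_law_atMost_eq[OF K, of m] b by (simp add: s_def spike_def ennreal_mult')
      also have "\<dots> = (\<integral>\<^sup>+x. ennreal b * indicator {..s} (x j) \<partial>data_law n (spike m j))"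
        using j by (subst nn_integral_data_law_component[symmetric, where n = n]) (auto simp: spike_pos nn_integral_cmult)
      also have "\<dots> \<le> (\<integral>\<^sup>+x. ennreal ((d x j - m)\<^sup>2) + ennreal A * (ennreal ((d x j)\<^sup>2) * indicator {..s} (x j)) \<partial>data_law n (spike m j))"
      proof (intro nn_integral_mono)
        fix x
        show "ennreal b * indicator {..s} (x j) \<le> ennreal ((d x j - m)\<^sup>2) + ennreal A * (ennreal ((d x j)\<^sup>2) * indicator {..s} (x j))"
          using weighted_two_point_sq_ge[OF A, of m "d x j"] A
          by (auto simp: b_def indicator_def ennreal_mult'[symmetric] ennreal_plus[symmetric] simp del: ennreal_plus intro!: ennreal_leI)
      qed
      also have "\<dots> = R j j + ennreal A * F"
        unfolding R_def F_def by (subst nn_integral_add) (auto simp: nn_integral_cmult)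
      \<comment> \<open>The weight \<open>A\<close> is spread in \<open>n - 1\<close> equal shares,
        one for each other spike position.\<close>
      also have "ennreal A * F = (\<Sum>i\<in>{..<n} - {j}. ennreal (exp (-s)) * F)"
        using j by (simp add: A_def s_def ennreal_mult' ennreal_of_nat_eq_real_of_nat of_nat_diff mult.assoc)
      also have "R j j + \<dots> \<le> R j j + (\<Sum>i\<in>{..<n} - {j}. R i j)"
        using off by (intro add_left_mono sum_mono) auto
      also have "\<dots> = (\<Sum>i<n. R i j)" using j by (subst sum.remove[of _ j]) auto
      finally show ?thesis .
    qed
    have "ennreal (b * (1 - exp (-K))) = (\<Sum>j<n. ennreal (b * (1 - exp (-K)))) / ennreal (real n)"
      using n b K by (simp add: ennreal_of_nat_eq_real_of_nat ennreal_mult'[symmetric] divide_ennreal)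
    also have "\<dots> \<le> (\<Sum>j<n. \<Sum>i<n. R i j) / ennreal (real n)"
      using col by (intro divide_right_mono_ennreal sum_mono) auto
    also have "\<dots> = (\<Sum>i<n. total_risk n d (spike m i)) / ennreal (real n)"
      unfolding tot by (subst sum.swap) simp
    also have "\<dots> = (\<integral>\<^sup>+g. total_risk n d g \<partial>measure_pmf W)"
      unfolding W_def using ne by (simp add: nn_integral_pmf_of_set ennreal_of_nat_eq_real_of_nat)
    finally show ?thesis .
  qed
  with W show ?thesis unfolding bayes_bound_def b_def by blast
qed

subsection \<open>The limit of the minimax risks\<close>

definition limit_risk :: "real \<Rightarrow> real \<Rightarrow> real" where
  "limit_risk p eta = enn2real (SUP n\<in>{0<..}. minimax_risk n p eta)"

context
  fixes p :: real
  assumes p: "0 < p" "p < 2"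
begin

text \<open>The threshold bound is uniform in \<open>n\<close>, so the supremum is finite and
  \<open>enn2real\<close> loses nothing. Any admissible threshold would do; \<open>exp 2\<close> is
  the smallest.\<close>

lemma ennreal_limit_risk: "ennreal (limit_risk p eta) = (SUP n\<in>{0<..}. minimax_risk n p eta)"
proof -
  have "(SUP n\<in>{0<..}. minimax_risk n p eta)
      \<le> ennreal (threshold_slope p (exp 2) * eta powr p + log_moment * exp (- (exp 2 - 1) / 2))"
    using p by (intro SUP_least minimax_risk_threshold_le) auto
  then show ?thesis unfolding limit_risk_def
    by (metis ennreal_enn2real_if ennreal_neq_top neq_top_trans)
qed

lemma limit_risk_le:
  assumes t: "t \<ge> exp 2"
  shows "limit_risk p eta \<le> threshold_slope p t * eta powr p + log_moment * exp (- (t - 1) / 2)"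
  unfolding limit_risk_def
proof (rule enn2real_leI)
  show "0 \<le> threshold_slope p t * eta powr p + log_moment * exp (- (t - 1) / 2)"
    using log_moment_nonneg by (simp add: threshold_slope_def)
  show "(SUP n\<in>{0<..}. minimax_risk n p eta) \<le> ennreal (threshold_slope p t * eta powr p + log_moment * exp (- (t - 1) / 2))"
    using p t by (intro SUP_least minimax_risk_threshold_le) auto
qed

lemma limit_risk_ge:
  assumes m: "m > 0" and K: "K \<ge> 0" and eta: "eta > 0" and large: "m powr p / eta powr p \<ge> 1"
  shows "m\<^sup>2 / (m powr p / eta powr p + 1) *
           (1 - 1 / (1 + (m powr p / eta powr p - 1) * exp (- (K * exp m)))) * (1 - exp (-K)) \<le> limit_risk p eta"
proof -
  define x where "x = m powr p / eta powr p"
  \<comment> \<open>The smallest sample size whose budget admits a spike of height \<open>m\<close>.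
    The sandwich \<open>x \<le> n \<le> x + 1\<close> then removes the rounding, so that the bound
    is an explicit function of real parameters.\<close>
  define n where "n = nat \<lceil>x\<rceil>"
  have x: "x \<ge> 1" using large by (simp add: x_def)
  have n: "x \<le> real n" "real n \<le> x + 1" unfolding n_def using x by linarith+
  have n0: "n > 0" using n x by (cases n) auto
  define A where "A = (real n - 1) * exp (- (K * exp m))"
  define A' where "A' = (x - 1) * exp (- (K * exp m))"
  have A: "0 \<le> A'" "A' \<le> A" using n x by (auto simp: A_def A'_def)
  have "m powr p \<le> real n * eta powr p" using n(1) eta by (simp add: x_def field_simps)
  then have "bayes_bound p eta n (m\<^sup>2 * (1 - 1 / (1 + A)) * (1 - exp (-K)))"
    unfolding A_def using n0 m K by (intro bayes_bound_spike) auto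
  then have "ennreal (m\<^sup>2 * (1 - 1 / (1 + A)) * (1 - exp (-K)) / real n) \<le> minimax_risk n p eta"
    by (rule minimax_risk_ge)
  also have "\<dots> \<le> ennreal (limit_risk p eta)"
    unfolding ennreal_limit_risk using n0 by (intro SUP_upper) auto
  finally have "m\<^sup>2 * (1 - 1 / (1 + A)) * (1 - exp (-K)) / real n \<le> limit_risk p eta"
    by (subst (asm) ennreal_le_iff) (auto simp: limit_risk_def)
  moreover have "m\<^sup>2 / (x + 1) * (1 - 1 / (1 + A')) * (1 - exp (-K)) \<le> m\<^sup>2 / real n * (1 - 1 / (1 + A)) * (1 - exp (-K))"
    using A n n0 K x by (intro mult_mono mult_right_mono divide_left_mono diff_left_mono) auto
  ultimately show ?thesis unfolding x_def[symmetric] A'_def[symmetric] by simp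
qed

lemma limit_risk_asymp:
  "((\<lambda>eta. limit_risk p eta / (eta powr p * ln (ln (1 / eta)) powr (2 - p))) \<longlongrightarrow> 1) (at_right 0)"
proof -
  define nrm where "nrm u = exp (-u) powr p * ln u powr (2 - p)" for u :: real
  define m where "m u = ln u - 2 * ln (ln u)" for u :: real
  \<comment> \<open>Here \<open>K = ln u\<close>: it makes \<open>1 - exp (-K) = 1 - 1 / u\<close>
    tend to 1. Moreover \<open>K * exp (m u) = u / ln u\<close> is negligible against
    \<open>p * u\<close>, so the odds against the spike still diverge.\<close>
  define lo where "lo u = (m u)\<^sup>2 / (m u powr p / exp (-u) powr p + 1) *
      (1 - 1 / (1 + (m u powr p / exp (-u) powr p - 1) * exp (- (ln u * exp (m u))))) * (1 - exp (- ln u))" for u :: real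
  \<comment> \<open>With \<open>t = 6 * u\<close> the null term is of order
    \<open>exp (-3 * u)\<close>, that is \<open>eta^3\<close>, which is negligible against
    \<open>eta^p\<close>; any factor above \<open>2 * p\<close> would do. Since
    \<open>ln (6 * u)\<close> is asymptotic to \<open>ln u\<close>, the factor does not affect the
    limit.\<close>
  define up where "up u = threshold_slope p (6 * u) * exp (-u) powr p + log_moment * exp (- (6 * u - 1) / 2)" for u
  have "((\<lambda>u. lo u / nrm u) \<longlongrightarrow> 1) at_top"
    unfolding lo_def nrm_def m_def using p by real_asymp
  moreover have "((\<lambda>u. up u / nrm u) \<longlongrightarrow> 1) at_top"
    unfolding up_def nrm_def threshold_slope_def using p by real_asymp
  moreover have "eventually (\<lambda>u. lo u / nrm u \<le> limit_risk p (exp (-u)) / nrm u) at_top"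
  proof -
    have "eventually (\<lambda>u. m u > 0) at_top" unfolding m_def by real_asymp
    moreover have "eventually (\<lambda>u. m u powr p / exp (-u) powr p \<ge> 1) at_top"
      unfolding m_def using p by real_asymp
    moreover have "eventually (\<lambda>u::real. ln u \<ge> 0) at_top" by real_asymp
    ultimately show ?thesis
    proof eventually_elim
      case (elim u)
      then show ?case
        unfolding lo_def by (intro divide_right_mono limit_risk_ge) (auto simp: nrm_def)
    qed
  qed
  moreover have "eventually (\<lambda>u. limit_risk p (exp (-u)) / nrm u \<le> up u / nrm u) at_top"
  proof -
    have "eventually (\<lambda>u::real. 6 * u \<ge> exp 2) at_top" by real_asymp
    then show ?thesis
    proof eventually_elim
      case (elim u)
      then show ?case
        unfolding up_def by (intro divide_right_mono limit_risk_le) (auto simp: nrm_def)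
    qed
  qed
  ultimately have "((\<lambda>u. limit_risk p (exp (-u)) / nrm u) \<longlongrightarrow> 1) at_top"
    using tendsto_sandwich[of "\<lambda>u. lo u / nrm u" "\<lambda>u. limit_risk p (exp (-u)) / nrm u" at_top "\<lambda>u. up u / nrm u" 1]
    by blast
  moreover have "filterlim (\<lambda>eta::real. ln (1 / eta)) at_top (at_right 0)" by real_asymp
  ultimately have "((\<lambda>eta. limit_risk p (exp (- ln (1 / eta))) / nrm (ln (1 / eta))) \<longlongrightarrow> 1) (at_right 0)"
    by (rule filterlim_compose)
  moreover have "eventually (\<lambda>eta::real. limit_risk p (exp (- ln (1 / eta))) / nrm (ln (1 / eta))
      = limit_risk p eta / (eta powr p * ln (ln (1 / eta)) powr (2 - p))) (at_right 0)"
    by (rule eventually_at_rightI[of 0 1]) (auto simp: nrm_def ln_div)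
  ultimately show ?thesis by (rule Lim_transform_eventually)
qed

end

theorem theorem1p1:
  fixes p :: real
  assumes "0 < p" and "p < 2"
  shows "\<exists>L :: real \<Rightarrow> real.
           (\<forall>eta>0. (\<lambda>n. minimax_risk n p eta) \<longlonglongrightarrow> ennreal (L eta)) \<and>
           ((\<lambda>eta. L eta / (eta powr p * (ln (ln (1 / eta))) powr (2 - p))) \<longlongrightarrow> 1) (at_right 0)"
proof (intro exI[of _ "limit_risk p"] conjI allI impI)
  fix eta :: real
  show "(\<lambda>n. minimax_risk n p eta) \<longlonglongrightarrow> ennreal (limit_risk p eta)"
    unfolding ennreal_limit_risk[OF assms] by (rule minimax_risk_tendsto_SUP[OF assms(1)])
qed (rule limit_risk_asymp[OF assms])

end
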